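(* Let $\Lambda$ be a non-negative random variable with distribution function $F_\Lambda$, $\overline{F}_\Lambda=1-F_\Lambda$, and $E(\Lambda)<1$. Let $\psi(u)$ be the ultimate ruin probability in the Gerber-Dickson model with $\mathrm{MP}(F_\Lambda)$ distributed claims. For $n\ge1$ let $\psi_n(u)$ be the ultimate ruin probability in the Gerber-Dickson model with $\mathrm{NBM}(\boldsymbol{\pi}_n,p_n)$ distributed claims, where $p_n=n/(n+1)$, $\boldsymbol{\pi}_n=(q(1,n),q(2,n),\ldots)$ and $q(k,n)=F_\Lambda(k/n)-F_\Lambda((k-1)/n)$. Then $$\psi(u)=\lim_{n\to\infty}\psi_n(u),\qquad u\ge0,$$ where $$\psi_n(u)=\sum_{k=0}^{\infty}\overline{C}_{k,n}\,P(Z=k)=E\left(\overline{C}_{Z,n}\right),\qquad Z\sim\mathrm{NegBin}(u,1/(1+n)),$$ and the sequence $\{\overline{C}_{k,n}\}_{k=0}^\infty$ is determined by $$\overline{C}_{0,n}=\sum_{j=0}^\infty\overline{F}_\Lambda(j/n)/n,$$ $$\overline{C}_{k,n}=\overline{C}_{0,n}\left[\sum_{i=1}^{k}f_{Ne}(i)\,\overline{C}_{k-i,n}+\overline{F}_{Ne}(k)\right],\quad k\ge1,$$ $$f_{Ne}(i)=\frac{\overline{F}_\Lambda((i-1)/n)}{\sum_{j=0}^\infty\overline{F}_\Lambda(j/n)},\quad i\ge1.$$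
   Context: Gerber-Dickson model: for an integer $u\ge0$ and i.i.d. random variables $Y_1,Y_2,\ldots$ (the claims) with values in $\{0,1,2,\ldots\}$, the risk process is $U(t)=u+t-\sum_{i=1}^{t}Y_i$, $t=0,1,2,\ldots$. The ruin time is $\tau=\min\{t\ge1: U(t)\le0\}$ ($\tau=\infty$ if the set is empty), and the ultimate ruin probability is $P(\tau<\infty\mid U(0)=u)$. The net profit condition is that the claims have mean less than $1$. Mixed Poisson: $X\sim\mathrm{MP}(F_\Lambda)$ means that conditionally on $\Lambda=\lambda$, $X$ has the $\mathrm{Poisson}(\lambda)$ distribution; then $E(X)=E(\Lambda)$, so $E(\Lambda)<1$ is the net profit condition for $\mathrm{MP}(F_\Lambda)$ claims. Notation: $\mathrm{NegBin}(k,p)$ is the negative binomial distribution with probability function $\mathrm{nb}(k,p)(x)=\binom{k+x-1}{x}p^k(1-p)^x$, $x=0,1,2,\ldots$; $\mathrm{NegBin}(0,p)$ is read as the point mass at $0$. For $\boldsymbol{\pi}=(q_1,q_2,\ldots)$ with $q_k\ge0$ and $\sum_{k\ge1}q_k=1$, and $p\in(0,1)$, $\mathrm{NBM}(\boldsymbol{\pi},p)$ is the distribution on $\{0,1,2,\ldots\}$ with probability function $f(x)=\sum_{k=1}^\infty q_k\,\mathrm{nb}(k,p)(x)$. The quantities $f_{Ne}$ depend on $n$, and $\overline{F}_{Ne}(k)=\sum_{i>k}f_{Ne}(i)$.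
   Formalization: The formula for ψ_n(u) is stated only for those n whose NBM claims have mean at most 1 (all large n); it fails when the mean exceeds 1. If P(Λ=0)>0, the weights q(k,n) sum to less than 1, and the missing mass is put on the point mass at 0. *)

theory Defs
  imports "HOL-Probability.Probability"
begin

section \<open>The Gerber-Dickson model\<close>

text \<open>The claims are \<open>Y 1, Y 2, \<dots>\<close>; the value \<open>Y 0\<close> is never used.\<close>

definition iid_claims :: "'a measure \<Rightarrow> (nat \<Rightarrow> 'a \<Rightarrow> nat) \<Rightarrow> (nat \<Rightarrow> real) \<Rightarrow> bool" where
  "iid_claims M Y f \<longleftrightarrow>
     prob_space M \<and>
     prob_space.indep_vars M (\<lambda>_. count_space UNIV) Y {1..} \<and>
     (\<forall>i\<ge>1. \<forall>x. measure M {\<omega> \<in> space M. Y i \<omega> = x} = f x)"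

definition risk_process :: "nat \<Rightarrow> (nat \<Rightarrow> 'a \<Rightarrow> nat) \<Rightarrow> nat \<Rightarrow> 'a \<Rightarrow> int" where
  "risk_process u Y t \<omega> = int u + int t - (\<Sum>i=1..t. int (Y i \<omega>))"

definition ruin_time :: "nat \<Rightarrow> (nat \<Rightarrow> 'a \<Rightarrow> nat) \<Rightarrow> 'a \<Rightarrow> enat" where
  "ruin_time u Y \<omega> = Inf {enat t | t. t \<ge> 1 \<and> risk_process u Y t \<omega> \<le> 0}"

definition ruin_prob :: "'a measure \<Rightarrow> (nat \<Rightarrow> 'a \<Rightarrow> nat) \<Rightarrow> nat \<Rightarrow> real" where
  "ruin_prob M Y u = measure M {\<omega> \<in> space M. ruin_time u Y \<omega> < \<infinity>}"

text \<open>The mean is taken in \<open>[0,\<infinity>]\<close>, so that an infinite mean is not read as \<open>0\<close>.\<close>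

definition claim_mean :: "'a measure \<Rightarrow> (nat \<Rightarrow> 'a \<Rightarrow> nat) \<Rightarrow> ennreal" where
  "claim_mean M Y = (\<integral>\<^sup>+\<omega>. ennreal (real (Y 1 \<omega>)) \<partial>M)"

section \<open>Claim distributions\<close>

text \<open>The library's \<open>poisson_pmf\<close> requires a positive rate. Here the rate \<open>0\<close> is allowed and
  gives the point mass at \<open>0\<close>, since \<open>0 ^ 0 = 1\<close>.\<close>

definition poisson_pf :: "real \<Rightarrow> nat \<Rightarrow> real" where
  "poisson_pf l x = exp (- l) * l ^ x / fact x"

text \<open>In \<open>mixed_poisson_pf D\<close> the measure \<open>D\<close> is the law of the mixing variable.\<close>

definition mixed_poisson_pf :: "real measure \<Rightarrow> nat \<Rightarrow> real" where
  "mixed_poisson_pf D x = (LINT l|D. poisson_pf l x)"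

text \<open>The weights are \<open>q 1, q 2, \<dots>\<close>. If they sum to \<open>1\<close>, the second summand vanishes and this is
  the usual mixture. If they sum to less than \<open>1\<close>, the missing mass is put on
  \<open>neg_binomial_pmf 0 p\<close>, the point mass at \<open>0\<close>; for the weights below this happens exactly when
  the mixing variable has an atom at \<open>0\<close>.\<close>

definition nbm_pf :: "(nat \<Rightarrow> real) \<Rightarrow> real \<Rightarrow> nat \<Rightarrow> real" where
  "nbm_pf q p x =
     (\<Sum>k. q (Suc k) * pmf (neg_binomial_pmf (Suc k) p) x)
     + (1 - (\<Sum>k. q (Suc k))) * pmf (neg_binomial_pmf 0 p) x"

section \<open>The approximating sequence\<close>

text \<open>Below, \<open>F\<close> is the distribution function of the mixing variable.\<close>

definition nbm_weight :: "(real \<Rightarrow> real) \<Rightarrow> nat \<Rightarrow> nat \<Rightarrow> real" where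
  "nbm_weight F n k = F (real k / real n) - F ((real k - 1) / real n)"

definition survival :: "(real \<Rightarrow> real) \<Rightarrow> real \<Rightarrow> real" where
  "survival F x = 1 - F x"

text \<open>If the mixing variable is \<open>0\<close> almost surely, the quotient is \<open>0 / 0 = 0\<close>.\<close>

definition f_Ne :: "(real \<Rightarrow> real) \<Rightarrow> nat \<Rightarrow> nat \<Rightarrow> real" where
  "f_Ne F n i = survival F ((real i - 1) / real n) / (\<Sum>j. survival F (real j / real n))"

definition F_Ne_bar :: "(real \<Rightarrow> real) \<Rightarrow> nat \<Rightarrow> nat \<Rightarrow> real" where
  "F_Ne_bar F n k = (\<Sum>i. f_Ne F n (Suc k + i))"

function C_bar :: "(real \<Rightarrow> real) \<Rightarrow> nat \<Rightarrow> nat \<Rightarrow> real" where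
  "C_bar F n 0 = (\<Sum>j. survival F (real j / real n) / real n)"
| "C_bar F n (Suc k) =
     C_bar F n 0 * ((\<Sum>i=1..Suc k. f_Ne F n i * C_bar F n (Suc k - i)) + F_Ne_bar F n (Suc k))"
  by pat_completeness auto
termination
  by (relation "Wellfounded.measure (\<lambda>(F, n, k). k)") auto

end

theory Submission
  imports Defs "HOL-Real_Asymp.Real_Asymp"
begin

text \<open>
  Both parts of the theorem rest on a renewal equation. Let \<open>\<phi> u = 1 - \<psi> u\<close> be the survival
  probability for claims with probability function \<open>f\<close> and mean \<open>\<mu> \<le> 1\<close>. Then
  \<open>\<phi> u = (1 - \<mu>) + (\<Sum>j<u. P (Y > j) * \<phi> (u - j))\<close> for all \<open>u\<close> (\<open>survival_prob_renewal\<close>). The recursive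
  part is a summation by parts of the equation that conditions on the first claim. The constant
  \<open>\<phi> 0 = 1 - \<mu>\<close> is bounded from below at finite time horizons, where survival becomes certain as the
  capital grows, and from above by letting the capital tend to infinity in the renewal equation.
  When \<open>f 0 > 0\<close>, the equation determines \<open>\<phi>\<close> by recursion on the capital.

  For the limit, note that the recursion expresses \<open>\<phi> u\<close> as a continuous function of \<open>\<mu>\<close> and of finitely
  many values of \<open>f\<close> (\<open>renewal_continuity\<close>). It is therefore enough that the claim probabilities
  and the mean claims converge. An \<open>NBM\<close> claim with the given weights is negative binomial with a
  random number \<open>K\<close> of successes, where \<open>K\<close> is \<open>n * \<Lambda>\<close> rounded up. As \<open>K / n\<close> tends to \<open>\<Lambda>\<close>, its
  distribution given \<open>\<Lambda>\<close> tends to the Poisson distribution with rate \<open>\<Lambda>\<close>, and dominated convergence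
  finishes the argument (\<open>nbm_claim_pf_tendsto\<close>, \<open>expectation_grid_tendsto\<close>).

  For the formula, put \<open>a i = survival F (i / n) / n = P (K > i) / n\<close>. The recursion for \<open>C_bar\<close> says that
  \<open>D k = 1 - C_bar F n k\<close> solves \<open>D k = (1 - \<mu>) + (\<Sum>i<k. a i * D (k - 1 - i))\<close> (\<open>C_bar_renewal\<close>). Two
  facts about coin flips carry this over to the average \<open>\<Phi> u\<close> of \<open>D\<close> over \<open>NegBin (u, 1 / (n + 1))\<close>.
  Exchanging heads and tails writes \<open>P (Y > j)\<close> as \<open>n\<close> times the average of \<open>a\<close> over
  \<open>NegBin (j + 1, 1 / (n + 1))\<close> (\<open>nbm_claim_tail_sums\<close>); splitting a sequence of flips at one of them
  turns the convolution of \<open>a\<close> with \<open>D\<close> into a convolution of the averages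
  (\<open>neg_binomial_convolution\<close>). So \<open>\<Phi>\<close> satisfies the renewal equation of the survival probability
  (\<open>neg_binomial_average_renewal\<close>) and equals it by uniqueness.
\<close>

section \<open>The renewal equation for the survival probability\<close>

definition claim_tail :: "(nat \<Rightarrow> real) \<Rightarrow> nat \<Rightarrow> real" where
  "claim_tail f j = 1 - (\<Sum>x\<le>j. f x)"

text \<open>\<open>survive f t u\<close> is the probability that a process with initial capital \<open>u\<close> and claim
  probability function \<open>f\<close> stays positive at the times \<open>1, \<dots>, t\<close>. The recursion conditions on the
  first claim \<open>y\<close>: the process survives the first period iff \<open>y \<le> u\<close>, and then restarts with
  capital \<open>u + 1 - y\<close>.\<close>

fun survive :: "(nat \<Rightarrow> real) \<Rightarrow> nat \<Rightarrow> nat \<Rightarrow> real" where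
  "survive f 0 u = 1"
| "survive f (Suc t) u = (\<Sum>y\<le>u. f y * survive f t (Suc u - y))"

text \<open>Summing the one-step equation \<open>\<phi> u = (\<Sum>y\<le>u. f y * \<phi> (u + 1 - y))\<close> over \<open>u\<close> turns it into a renewal
  equation in the tails of \<open>f\<close>; this function is the quantity that the summation keeps constant.\<close>

definition renewal_defect :: "(nat \<Rightarrow> real) \<Rightarrow> (nat \<Rightarrow> real) \<Rightarrow> nat \<Rightarrow> real" where
  "renewal_defect f \<phi> u = \<phi> u - (\<Sum>j<u. claim_tail f j * \<phi> (u - j))"

text \<open>The increment of the defect is exactly the error of \<open>\<phi>\<close> in the one-step equation, so that the
  defect is constant for a solution. It also makes the defect of the finite-horizon probabilities
  decreasing, because there the error is a decrement in time.\<close>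

lemma renewal_defect_Suc:
  "renewal_defect f \<phi> (Suc u) = renewal_defect f \<phi> u + ((\<Sum>y\<le>u. f y * \<phi> (Suc u - y)) - \<phi> u)"
proof -
  have tail: "claim_tail f (Suc j) = claim_tail f j - f (Suc j)" for j
    by (simp add: claim_tail_def)
  have "(\<Sum>y\<le>u. f y * \<phi> (Suc u - y)) = f 0 * \<phi> (Suc u) + (\<Sum>j<u. f (Suc j) * \<phi> (u - j))"
    by (subst sum.atMost_shift) simp
  moreover have "(\<Sum>j<Suc u. claim_tail f j * \<phi> (Suc u - j)) =
      (1 - f 0) * \<phi> (Suc u) + (\<Sum>j<u. claim_tail f (Suc j) * \<phi> (u - j))"
    by (subst sum.lessThan_Suc_shift) (simp add: claim_tail_def)
  ultimately show ?thesis
    by (simp add: renewal_defect_def tail left_diff_distrib sum_subtractf)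
qed

locale claim_distribution =
  fixes f :: "nat \<Rightarrow> real"
  assumes nonneg: "0 \<le> f x" and total: "f sums 1"
begin

lemma partial_sum_le_1: "(\<Sum>x\<le>j. f x) \<le> 1"
  using sum_le_suminf[of f "{..j}"] total nonneg by (auto simp: sums_iff)

lemma claim_tail_nonneg: "0 \<le> claim_tail f j"
  using partial_sum_le_1 by (simp add: claim_tail_def)

lemma survive_nonneg: "0 \<le> survive f t u"
  by (induction t arbitrary: u) (auto intro!: sum_nonneg mult_nonneg_nonneg nonneg)

lemma survive_le_1: "survive f t u \<le> 1"
proof (induction t arbitrary: u)
  case (Suc t)
  have "survive f (Suc t) u \<le> (\<Sum>y\<le>u. f y * 1)"
    unfolding survive.simps by (intro sum_mono mult_left_mono Suc nonneg)
  then show ?case using partial_sum_le_1[of u] by simp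
qed simp

lemma survive_antimono_time: "survive f (Suc t) u \<le> survive f t u"
proof (induction t arbitrary: u)
  case 0
  show ?case using survive_le_1[of "Suc 0" u] by simp
next
  case (Suc t)
  then show ?case
    unfolding survive.simps(2)[of f "Suc t"] survive.simps(2)[of f t]
    by (intro sum_mono mult_left_mono nonneg)
qed

lemma survive_mono_capital: "survive f t u \<le> survive f t (Suc u)"
proof (induction t arbitrary: u)
  case (Suc t)
  have "(\<Sum>y\<le>u. f y * survive f t (Suc u - y)) \<le> (\<Sum>y\<le>u. f y * survive f t (Suc (Suc u) - y))"
    using Suc by (intro sum_mono mult_left_mono nonneg) (simp add: Suc_diff_le)
  also have "\<dots> \<le> (\<Sum>y\<le>Suc u. f y * survive f t (Suc (Suc u) - y))"
    by (simp add: nonneg survive_nonneg)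
  finally show ?case by simp
qed simp

lemma survive_tendsto_1: "(\<lambda>u. survive f t u) \<longlonglongrightarrow> 1"
proof (induction t)
  case (Suc t)
  have inc: "incseq (survive f (Suc t))"
    by (rule incseq_SucI) (rule survive_mono_capital)
  have "\<forall>u. survive f (Suc t) u \<le> 1" by (intro allI survive_le_1)
  from incseq_convergent[OF inc this] obtain l where l: "survive f (Suc t) \<longlonglongrightarrow> l" .
  have partial: "(\<Sum>y\<le>J. f y) \<le> l" for J
  proof (rule LIMSEQ_le)
    have "(\<lambda>u. survive f t (Suc u - y)) \<longlonglongrightarrow> 1" for y
      by (rule filterlim_compose[OF Suc])
         (rule filterlim_compose[OF filterlim_minus_const_nat_at_top filterlim_Suc])
    from tendsto_sum[OF tendsto_mult_left[OF this]]
    show "(\<lambda>u. \<Sum>y\<le>J. f y * survive f t (Suc u - y)) \<longlonglongrightarrow> (\<Sum>y\<le>J. f y)"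
      by simp
    show "\<exists>N. \<forall>u\<ge>N. (\<Sum>y\<le>J. f y * survive f t (Suc u - y)) \<le> survive f (Suc t) u"
      by (intro exI[of _ J] allI impI)
         (auto intro!: sum_mono2 mult_nonneg_nonneg nonneg survive_nonneg)
  qed (rule l)
  have "(\<lambda>J. \<Sum>y\<le>J. f y) \<longlonglongrightarrow> 1"
    using total by (simp add: sums_def_le)
  then have "1 \<le> l"
    by (rule LIMSEQ_le_const2) (use partial in blast)
  moreover have "l \<le> 1"
    using l by (rule LIMSEQ_le_const2) (use survive_le_1 in blast)
  ultimately have "l = 1" by simp
  with l show ?case by (simp del: survive.simps)
qed simp

text \<open>For a finite horizon the defect decreases in the capital, and for large capital it is at least
  about \<open>1 - \<mu>\<close>, since survival up to a fixed time becomes certain. At capital \<open>0\<close> the defect is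
  the survival probability itself.\<close>

lemma survive_0_ge:
  assumes tail: "(claim_tail f) sums \<mu>"
  shows "1 - \<mu> \<le> survive f t 0"
proof -
  let ?R = "renewal_defect f (survive f t)"
  have dec: "?R (Suc u) \<le> ?R u" for u
    using survive_antimono_time[of t u] by (simp add: renewal_defect_Suc)
  have "survive f t u - \<mu> \<le> survive f t 0" for u
  proof -
    have "(\<Sum>j<u. claim_tail f j * survive f t (u - j)) \<le> (\<Sum>j<u. claim_tail f j * 1)"
      by (intro sum_mono mult_left_mono survive_le_1 claim_tail_nonneg)
    also have "\<dots> \<le> \<mu>"
      using sum_le_suminf[of "claim_tail f" "{..<u}"] tail claim_tail_nonneg by (auto simp: sums_iff)
    finally have "survive f t u - \<mu> \<le> ?R u"
      by (simp add: renewal_defect_def)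
    also have "\<dots> \<le> ?R 0"
      using lift_Suc_antimono_le[of ?R 0 u] dec by blast
    finally show ?thesis by (simp add: renewal_defect_def)
  qed
  moreover have "(\<lambda>u. survive f t u - \<mu>) \<longlonglongrightarrow> 1 - \<mu>"
    by (intro tendsto_intros survive_tendsto_1)
  ultimately show ?thesis
    using LIMSEQ_le_const2 by blast
qed

text \<open>Since the defect of the survival function \<open>\<phi>\<close> is constant, only \<open>\<phi> 0 = 1 - \<mu>\<close> is at stake. The lower
  bound is inherited from the finite horizons. For the upper bound, let the capital tend to
  infinity in the renewal equation: the limit \<open>l \<le> 1\<close> of \<open>\<phi>\<close> satisfies \<open>\<phi> 0 + \<mu> * l \<le> l\<close>, and
  \<open>\<mu> \<le> 1\<close> gives \<open>\<phi> 0 \<le> 1 - \<mu>\<close>.\<close>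

lemma survival_renewal:
  assumes lim: "\<And>u. (\<lambda>t. survive f t u) \<longlonglongrightarrow> \<phi> u"
    and tail: "(claim_tail f) sums \<mu>" and "\<mu> \<le> 1"
  shows "\<phi> u = (1 - \<mu>) + (\<Sum>j<u. claim_tail f j * \<phi> (u - j))"
proof -
  have \<phi>_le_1: "\<phi> u \<le> 1" for u
    using lim by (rule LIMSEQ_le_const2) (use survive_le_1 in blast)
  have \<phi>_nonneg: "0 \<le> \<phi> u" for u
    using lim by (rule LIMSEQ_le_const) (use survive_nonneg in blast)
  have inc: "incseq \<phi>"
    by (intro incseq_SucI) (rule LIMSEQ_le[OF lim lim], use survive_mono_capital in blast)
  have one_step: "(\<Sum>y\<le>u. f y * \<phi> (Suc u - y)) = \<phi> u" for u
  proof (rule LIMSEQ_unique)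
    show "(\<lambda>t. survive f (Suc t) u) \<longlonglongrightarrow> (\<Sum>y\<le>u. f y * \<phi> (Suc u - y))"
      unfolding survive.simps by (intro tendsto_intros lim)
    show "(\<lambda>t. survive f (Suc t) u) \<longlonglongrightarrow> \<phi> u"
      using lim by (rule LIMSEQ_Suc)
  qed
  have const: "renewal_defect f \<phi> u = \<phi> 0" for u
    by (induction u) (simp_all add: renewal_defect_Suc one_step, simp add: renewal_defect_def)
  have "\<phi> 0 \<le> 1 - \<mu>"
  proof -
    have "\<forall>u. \<phi> u \<le> 1" by (intro allI \<phi>_le_1)
    from incseq_convergent[OF inc this] obtain l where l: "\<phi> \<longlonglongrightarrow> l" .
    have "l \<le> 1"
      using l by (rule LIMSEQ_le_const2) (use \<phi>_le_1 in blast)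
    have below: "\<phi> 0 + (\<Sum>j<J. claim_tail f j) * l \<le> l" for J
    proof (rule LIMSEQ_le)
      show "(\<lambda>u. \<phi> 0 + (\<Sum>j<J. claim_tail f j) * \<phi> u) \<longlonglongrightarrow> \<phi> 0 + (\<Sum>j<J. claim_tail f j) * l"
        by (intro tendsto_intros l)
      show "(\<lambda>u. \<phi> (u + J)) \<longlonglongrightarrow> l"
        using l by (rule LIMSEQ_ignore_initial_segment)
      have "\<phi> 0 + (\<Sum>j<J. claim_tail f j) * \<phi> u \<le> \<phi> (u + J)" for u
      proof -
        have "(\<Sum>j<J. claim_tail f j) * \<phi> u \<le> (\<Sum>j<J. claim_tail f j * \<phi> (u + J - j))"
          unfolding sum_distrib_right
          by (intro sum_mono mult_left_mono claim_tail_nonneg incseqD[OF inc]) auto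
        also have "\<dots> \<le> (\<Sum>j<u + J. claim_tail f j * \<phi> (u + J - j))"
          by (intro sum_mono2) (auto intro!: mult_nonneg_nonneg claim_tail_nonneg \<phi>_nonneg)
        finally show ?thesis
          using const[of "u + J"] by (simp add: renewal_defect_def)
      qed
      then show "\<exists>N. \<forall>u\<ge>N. \<phi> 0 + (\<Sum>j<J. claim_tail f j) * \<phi> u \<le> \<phi> (u + J)"
        by blast
    qed
    have "(\<lambda>J. \<phi> 0 + (\<Sum>j<J. claim_tail f j) * l) \<longlonglongrightarrow> \<phi> 0 + \<mu> * l"
      using tail unfolding sums_def by (intro tendsto_intros)
    then have "\<phi> 0 + \<mu> * l \<le> l"
      by (rule LIMSEQ_le_const2) (use below in blast)
    then have "\<phi> 0 \<le> (1 - \<mu>) * l" by (simp add: algebra_simps)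
    also have "\<dots> \<le> 1 - \<mu>"
      using \<open>l \<le> 1\<close> \<open>\<mu> \<le> 1\<close> by (simp add: mult_left_le)
    finally show ?thesis .
  qed
  moreover have "1 - \<mu> \<le> \<phi> 0"
    using lim by (rule LIMSEQ_le_const) (use survive_0_ge[OF tail] in blast)
  ultimately show ?thesis
    using const[of u] by (simp add: renewal_defect_def)
qed

end

text \<open>If claims vanish with positive probability, the term \<open>j = 0\<close> can be moved to the left, where it
  leaves the factor \<open>f 0\<close>. Each value of the solution is then a continuous function of \<open>c\<close>,
  finitely many values of \<open>f\<close>, and the earlier values of the solution.\<close>

lemma renewal_continuity:
  assumes "f 0 \<noteq> 0"
    and f: "\<And>x. (\<lambda>n. fn n x) \<longlonglongrightarrow> f x" and c: "cn \<longlonglongrightarrow> c"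
    and xn: "\<forall>\<^sub>F n in sequentially. \<forall>u. xn n u = cn n + (\<Sum>j<u. claim_tail (fn n) j * xn n (u - j))"
    and x: "\<And>u. x u = c + (\<Sum>j<u. claim_tail f j * x (u - j))"
  shows "(\<lambda>n. xn n u) \<longlonglongrightarrow> x u"
proof (induction u rule: less_induct)
  case (less u)
  show ?case
  proof (cases u)
    case 0
    have "\<forall>\<^sub>F n in sequentially. cn n = xn n u"
      using xn
    proof eventually_elim
      case (elim n)
      from spec[OF elim, of 0] show ?case by (simp add: 0)
    qed
    from Lim_transform_eventually[OF c this] show ?thesis
      using x[of 0] by (simp add: 0)
  next
    case (Suc v)
    have tail: "(\<lambda>n. claim_tail (fn n) j) \<longlonglongrightarrow> claim_tail f j" for j
      unfolding claim_tail_def by (intro tendsto_intros f)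
    let ?num = "\<lambda>c f x. c + (\<Sum>j<v. claim_tail f (Suc j) * x (v - j)) :: real"
    have eq: "f 0 * x u = ?num c f x"
      if "\<And>u. x u = c + (\<Sum>j<u. claim_tail f j * x (u - j))" for c f x
      using that[of u] unfolding Suc sum.lessThan_Suc_shift by (simp add: claim_tail_def algebra_simps)
    have "(\<lambda>n. ?num (cn n) (fn n) (xn n) / fn n 0) \<longlonglongrightarrow> ?num c f x / f 0"
      using less Suc \<open>f 0 \<noteq> 0\<close> by (intro tendsto_intros c tail f less) auto
    also have "?num c f x / f 0 = x u"
      using eq[OF x] \<open>f 0 \<noteq> 0\<close> by (simp add: field_simps)
    finally have lim: "(\<lambda>n. ?num (cn n) (fn n) (xn n) / fn n 0) \<longlonglongrightarrow> x u" .
    have "\<forall>\<^sub>F n in sequentially. fn n 0 \<noteq> 0"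
      using f \<open>f 0 \<noteq> 0\<close> by (rule tendsto_imp_eventually_ne)
    with xn have "\<forall>\<^sub>F n in sequentially. ?num (cn n) (fn n) (xn n) / fn n 0 = xn n u"
    proof eventually_elim
      case (elim n)
      have "fn n 0 * xn n u = ?num (cn n) (fn n) (xn n)"
        by (rule eq) (use elim(1) in blast)
      with elim(2) show ?case by (simp add: field_simps)
    qed
    then show ?thesis using lim by (rule Lim_transform_eventually[rotated])
  qed
qed

text \<open>Continuity with a constant sequence of equations: the constant sequence \<open>y u\<close> tends to \<open>x u\<close>.\<close>

lemma renewal_unique:
  assumes "f 0 \<noteq> 0"
    and x: "\<And>u. x u = c + (\<Sum>j<u. claim_tail f j * x (u - j))"
    and y: "\<And>u. y u = c + (\<Sum>j<u. claim_tail f j * y (u - j))"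
  shows "x u = y u"
proof -
  have "(\<lambda>n::nat. y u) \<longlonglongrightarrow> x u"
    by (rule renewal_continuity[where f = f and c = c and fn = "\<lambda>_. f" and cn = "\<lambda>_. c"])
       (use \<open>f 0 \<noteq> 0\<close> in simp, rule tendsto_const, rule tendsto_const,
        intro always_eventually allI y, rule x)
  then show ?thesis by (simp add: LIMSEQ_const_iff)
qed

section \<open>Ruin under independent and identically distributed claims\<close>

lemma measurable_sum_nat [measurable]:
  fixes X :: "'i \<Rightarrow> 'a \<Rightarrow> nat"
  assumes "\<And>i. i \<in> A \<Longrightarrow> X i \<in> M \<rightarrow>\<^sub>M count_space UNIV"
  shows "(\<lambda>\<omega>. \<Sum>i\<in>A. X i \<omega>) \<in> M \<rightarrow>\<^sub>M count_space UNIV"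
  using assms
proof (induction A rule: infinite_finite_induct)
  case (insert a A)
  then have [measurable]: "X a \<in> M \<rightarrow>\<^sub>M count_space UNIV"
    "(\<lambda>\<omega>. \<Sum>i\<in>A. X i \<omega>) \<in> M \<rightarrow>\<^sub>M count_space UNIV" by auto
  show ?case unfolding sum.insert[OF insert(1,2)] by measurable
qed auto

lemma sets_partial_sums_bounded:
  fixes X :: "nat \<Rightarrow> 'a \<Rightarrow> nat"
  assumes [measurable]: "\<And>i. X i \<in> M \<rightarrow>\<^sub>M count_space UNIV"
  shows "{\<omega> \<in> space M. \<forall>s<t. (\<Sum>i\<le>s. X i \<omega>) \<le> v + s} \<in> sets M"
  by measurable

lemma partial_sums_bounded_Suc:
  fixes x :: "nat \<Rightarrow> nat"
  shows "(\<forall>s<Suc t. (\<Sum>i\<le>s. x (m + i)) \<le> u + s) \<longleftrightarrow>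
    x m \<le> u \<and> (\<forall>s<t. (\<Sum>i\<le>s. x (Suc m + i)) \<le> (Suc u - x m) + s)"
proof -
  have shift: "a + b \<le> u + Suc s \<longleftrightarrow> b \<le> (Suc u - a) + s" if "a \<le> u" for a b s :: nat
    using that by arith
  have "(\<forall>s<Suc t. (\<Sum>i\<le>s. x (m + i)) \<le> u + s) \<longleftrightarrow>
      x m \<le> u \<and> (\<forall>s<t. x m + (\<Sum>i\<le>s. x (Suc m + i)) \<le> u + Suc s)"
    by (simp add: All_less_Suc2 sum.atMost_Suc_shift del: sum.atMost_Suc)
  also have "\<dots> \<longleftrightarrow> x m \<le> u \<and> (\<forall>s<t. (\<Sum>i\<le>s. x (Suc m + i)) \<le> (Suc u - x m) + s)"
    by (intro conj_cong all_cong1 imp_cong refl shift)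
  finally show ?thesis .
qed

lemma risk_process_Suc_nonpos_iff:
  "risk_process u Y (Suc s) \<omega> \<le> 0 \<longleftrightarrow> \<not> (\<Sum>i\<le>s. Y (1 + i) \<omega>) \<le> u + s"
proof -
  have "(\<Sum>i = 1..Suc s. int (Y i \<omega>)) = (\<Sum>i\<le>s. int (Y (Suc i) \<omega>))"
    unfolding One_nat_def sum.shift_bounds_cl_Suc_ivl by (simp add: atMost_atLeast0)
  also have "\<dots> = int (\<Sum>i\<le>s. Y (1 + i) \<omega>)"
    by simp
  finally have "risk_process u Y (Suc s) \<omega> = int u + int (Suc s) - int (\<Sum>i\<le>s. Y (1 + i) \<omega>)"
    by (simp only: risk_process_def)
  moreover have "int u + int (Suc s) - int x \<le> 0 \<longleftrightarrow> \<not> x \<le> u + s" for x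
    by auto
  ultimately show ?thesis by (simp only:)
qed

lemma ruin_time_finite_iff:
  "ruin_time u Y \<omega> < \<infinity> \<longleftrightarrow> (\<exists>s. \<not> (\<Sum>i\<le>s. Y (1 + i) \<omega>) \<le> u + s)"
proof -
  have "ruin_time u Y \<omega> < \<infinity> \<longleftrightarrow> (\<exists>t\<ge>1. risk_process u Y t \<omega> \<le> 0)"
    unfolding ruin_time_def Inf_less_iff by auto
  also have "\<dots> \<longleftrightarrow> (\<exists>s. risk_process u Y (Suc s) \<omega> \<le> 0)"
    by (metis One_nat_def Suc_le_D Suc_le_mono le0)
  finally show ?thesis
    by (simp only: risk_process_Suc_nonpos_iff)
qed

lemma iid_claims_prob_space: "iid_claims M Y f \<Longrightarrow> prob_space M"
  by (simp add: iid_claims_def)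

lemma iid_claims_measurable:
  assumes "iid_claims M Y f" and "1 \<le> i"
  shows "Y i \<in> M \<rightarrow>\<^sub>M count_space UNIV"
proof -
  have "prob_space M" and "prob_space.indep_vars M (\<lambda>_. count_space UNIV) Y {1..}"
    using assms(1) by (auto simp: iid_claims_def)
  then show ?thesis
    using assms(2) by (simp add: prob_space.indep_vars_def)
qed

lemma iid_claims_prob:
  "iid_claims M Y f \<Longrightarrow> 1 \<le> i \<Longrightarrow> measure M {\<omega> \<in> space M. Y i \<omega> = x} = f x"
  by (simp add: iid_claims_def)

lemma (in prob_space) nat_rv_prob_sums:
  assumes [measurable]: "K \<in> M \<rightarrow>\<^sub>M count_space (UNIV :: nat set)"
  shows "(\<lambda>k. prob {\<omega> \<in> space M. K \<omega> = k}) sums 1"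
proof -
  have "(\<lambda>k. prob {\<omega> \<in> space M. K \<omega> = k}) sums prob (\<Union>k. {\<omega> \<in> space M. K \<omega> = k})"
    by (rule finite_measure_UNION) (auto simp: disjoint_family_on_def)
  also have "(\<Union>k. {\<omega> \<in> space M. K \<omega> = k}) = space M"
    by auto
  finally show ?thesis by (simp add: prob_space)
qed

lemma iid_claims_distribution:
  assumes iid: "iid_claims M Y f"
  shows "claim_distribution f"
proof
  interpret prob_space M using iid by (rule iid_claims_prob_space)
  have f: "f = (\<lambda>x. prob {\<omega> \<in> space M. Y 1 \<omega> = x})"
    using iid_claims_prob[OF iid, of 1] by auto
  show "0 \<le> f x" for x
    by (simp add: f)
  show "f sums 1"
    unfolding f by (rule nat_rv_prob_sums[OF iid_claims_measurable[OF iid le_refl]])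
qed

text \<open>The claims are indexed from an arbitrary \<open>m\<close> because the induction on the horizon conditions on
  the first claim \<open>Y m\<close> and continues with the claims from \<open>Suc m\<close> on, which are independent of
  it.\<close>

lemma prob_survive:
  assumes iid: "iid_claims M Y f" and "1 \<le> m"
  shows "measure M {\<omega> \<in> space M. \<forall>s<t. (\<Sum>i\<le>s. Y (m + i) \<omega>) \<le> u + s} = survive f t u"
  using \<open>1 \<le> m\<close>
proof (induction t arbitrary: m u)
  case 0
  show ?case using prob_space.prob_space[OF iid_claims_prob_space[OF iid]] by simp
next
  case (Suc t)
  interpret prob_space M using iid by (rule iid_claims_prob_space)
  have meas: "Y (m + i) \<in> M \<rightarrow>\<^sub>M count_space UNIV" for i
    using iid_claims_measurable[OF iid] Suc.prems by simp
  from this[of 0] have [measurable]: "Y m \<in> M \<rightarrow>\<^sub>M count_space UNIV"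
    by simp
  define E where "E v = {\<omega> \<in> space M. \<forall>s<t. (\<Sum>i\<le>s. Y (Suc m + i) \<omega>) \<le> v + s}" for v
  have [measurable]: "E v \<in> sets M" for v
    unfolding E_def by (rule sets_partial_sums_bounded) (use meas[of "Suc i" for i] in simp)
  have split: "prob ({\<omega> \<in> space M. Y m \<omega> = y} \<inter> E v) = f y * survive f t v" for y v
  proof -
    let ?C = "\<lambda>_::nat. count_space (UNIV :: nat set)"
    let ?A = "{g \<in> space (PiM {m} ?C). g m = y}"
    let ?B = "{g \<in> space (PiM {Suc m..} ?C). \<forall>s<t. (\<Sum>i\<le>s. g (Suc m + i)) \<le> v + s}"
    have "indep_vars ?C Y {1..}"
      using iid by (simp add: iid_claims_def)
    then have indep: "indep_var (PiM {m} ?C) (\<lambda>\<omega>. restrict (\<lambda>i. Y i \<omega>) {m})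
        (PiM {Suc m..} ?C) (\<lambda>\<omega>. restrict (\<lambda>i. Y i \<omega>) {Suc m..})"
      using Suc.prems by (intro indep_var_restrict) auto
    have A: "?A \<in> sets (PiM {m} ?C)" by measurable
    have B: "?B \<in> sets (PiM {Suc m..} ?C)"
      by (intro sets_partial_sums_bounded measurable_component_singleton) simp
    have "prob ({\<omega> \<in> space M. Y m \<omega> = y} \<inter> E v) =
        prob ((\<lambda>\<omega>. (restrict (\<lambda>i. Y i \<omega>) {m}, restrict (\<lambda>i. Y i \<omega>) {Suc m..})) -` (?A \<times> ?B) \<inter> space M)"
      by (intro arg_cong[where f = prob]) (auto simp: E_def space_PiM)
    also have "\<dots> = prob ((\<lambda>\<omega>. restrict (\<lambda>i. Y i \<omega>) {m}) -` ?A \<inter> space M) *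
        prob ((\<lambda>\<omega>. restrict (\<lambda>i. Y i \<omega>) {Suc m..}) -` ?B \<inter> space M)"
      by (rule indep_varD[OF indep A B])
    also have "(\<lambda>\<omega>. restrict (\<lambda>i. Y i \<omega>) {m}) -` ?A \<inter> space M = {\<omega> \<in> space M. Y m \<omega> = y}"
      by (auto simp: space_PiM)
    also have "(\<lambda>\<omega>. restrict (\<lambda>i. Y i \<omega>) {Suc m..}) -` ?B \<inter> space M = E v"
      by (auto simp: space_PiM E_def)
    also have "prob (E v) = survive f t v"
      unfolding E_def by (rule Suc.IH) simp
    finally show ?thesis
      using iid_claims_prob[OF iid Suc.prems] by simp
  qed
  have "{\<omega> \<in> space M. \<forall>s<Suc t. (\<Sum>i\<le>s. Y (m + i) \<omega>) \<le> u + s} =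
      (\<Union>y\<le>u. {\<omega> \<in> space M. Y m \<omega> = y} \<inter> E (Suc u - y))"
    unfolding partial_sums_bounded_Suc[where x = "\<lambda>i. Y i \<omega>" for \<omega>] by (auto simp: E_def)
  also have "prob \<dots> = (\<Sum>y\<le>u. prob ({\<omega> \<in> space M. Y m \<omega> = y} \<inter> E (Suc u - y)))"
    by (intro finite_measure_finite_Union) (auto simp: disjoint_family_on_def)
  finally show ?case
    unfolding split survive.simps .
qed

text \<open>Surviving forever is the decreasing intersection of the finite-horizon survival events.\<close>

lemma survive_tendsto_survival:
  assumes iid: "iid_claims M Y f"
  shows "(\<lambda>t. survive f t u) \<longlonglongrightarrow> 1 - ruin_prob M Y u"
proof -
  interpret prob_space M using iid by (rule iid_claims_prob_space)
  define E where "E t = {\<omega> \<in> space M. \<forall>s<t. (\<Sum>i\<le>s. Y (1 + i) \<omega>) \<le> u + s}" for t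
  have [measurable]: "E t \<in> sets M" for t
    unfolding E_def by (intro sets_partial_sums_bounded iid_claims_measurable[OF iid]) simp
  have "(\<lambda>t. prob (E t)) \<longlonglongrightarrow> prob (\<Inter>t. E t)"
  proof (rule finite_Lim_measure_decseq)
    show "range E \<subseteq> events" by auto
    show "decseq E"
      by (rule decseq_SucI) (simp add: E_def subset_eq)
  qed
  moreover have "{\<omega> \<in> space M. ruin_time u Y \<omega> < \<infinity>} = space M - (\<Inter>t. E t)"
  proof -
    have "(\<forall>t. \<forall>s<t. P s) \<longleftrightarrow> (\<forall>s. P s)" for P :: "nat \<Rightarrow> bool"
      using lessI by blast
    then have "(\<Inter>t. E t) = {\<omega> \<in> space M. \<forall>s. (\<Sum>i\<le>s. Y (1 + i) \<omega>) \<le> u + s}"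
      by (simp add: E_def set_eq_iff)
    then show ?thesis
      unfolding ruin_time_finite_iff by auto
  qed
  then have "ruin_prob M Y u = 1 - prob (\<Inter>t. E t)"
    unfolding ruin_prob_def by (simp add: prob_compl del: plus_1_eq_Suc)
  ultimately show ?thesis
    unfolding E_def prob_survive[OF iid le_refl] by simp
qed

lemma claim_mean_eq_sum_tails:
  assumes iid: "iid_claims M Y f"
  shows "claim_mean M Y = (\<Sum>j. ennreal (claim_tail f j))"
proof -
  interpret prob_space M using iid by (rule iid_claims_prob_space)
  have [measurable]: "Y 1 \<in> M \<rightarrow>\<^sub>M count_space UNIV"
    using iid_claims_measurable[OF iid] by blast
  have tail: "prob {\<omega> \<in> space M. j < Y 1 \<omega>} = claim_tail f j" for j
  proof -
    have "{\<omega> \<in> space M. j < Y 1 \<omega>} = space M - (\<Union>x\<le>j. {\<omega> \<in> space M. Y 1 \<omega> = x})"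
      by auto
    also have "prob \<dots> = 1 - prob (\<Union>x\<le>j. {\<omega> \<in> space M. Y 1 \<omega> = x})"
      by (rule prob_compl) measurable
    also have "prob (\<Union>x\<le>j. {\<omega> \<in> space M. Y 1 \<omega> = x}) = (\<Sum>x\<le>j. f x)"
      by (subst finite_measure_finite_Union)
         (auto simp: disjoint_family_on_def iid_claims_prob[OF iid] simp del: One_nat_def)
    finally show ?thesis by (simp add: claim_tail_def)
  qed
  have "claim_mean M Y = (\<integral>\<^sup>+\<omega>. of_nat (Y 1 \<omega>) \<partial>M)"
    by (simp add: claim_mean_def ennreal_of_nat_eq_real_of_nat)
  also have "\<dots> = (\<Sum>j. emeasure M {\<omega> \<in> space M. j < Y 1 \<omega>})"
    by (rule nn_integral_nat_function) measurable
  finally show ?thesis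
    unfolding emeasure_eq_measure tail .
qed

lemma claim_mean_eq_sum:
  assumes iid: "iid_claims M Y f"
  shows "claim_mean M Y = (\<Sum>x. ennreal (real x * f x))"
proof -
  interpret prob_space M using iid by (rule iid_claims_prob_space)
  have [measurable]: "Y 1 \<in> M \<rightarrow>\<^sub>M count_space UNIV"
    using iid_claims_measurable[OF iid] by blast
  have "claim_mean M Y = (\<integral>\<^sup>+\<omega>. (\<Sum>x. ennreal (real x) * indicator {\<omega> \<in> space M. Y 1 \<omega> = x} \<omega>) \<partial>M)"
    unfolding claim_mean_def
  proof (rule nn_integral_cong)
    fix \<omega> assume "\<omega> \<in> space M"
    then have "(\<Sum>x. ennreal (real x) * indicator {\<omega> \<in> space M. Y 1 \<omega> = x} \<omega>) =
        (\<Sum>x\<in>{Y 1 \<omega>}. ennreal (real x) * indicator {\<omega> \<in> space M. Y 1 \<omega> = x} \<omega>)"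
      by (intro suminf_finite) auto
    then show "ennreal (real (Y 1 \<omega>)) = (\<Sum>x. ennreal (real x) * indicator {\<omega> \<in> space M. Y 1 \<omega> = x} \<omega>)"
      using \<open>\<omega> \<in> space M\<close> by simp
  qed
  also have "\<dots> = (\<Sum>x. \<integral>\<^sup>+\<omega>. ennreal (real x) * indicator {\<omega> \<in> space M. Y 1 \<omega> = x} \<omega> \<partial>M)"
    by (rule nn_integral_suminf) measurable
  also have "\<dots> = (\<Sum>x. ennreal (real x) * emeasure M {\<omega> \<in> space M. Y 1 \<omega> = x})"
    by (intro suminf_cong nn_integral_cmult_indicator) measurable
  also have "\<dots> = (\<Sum>x. ennreal (real x * f x))"
    using iid_claims_prob[OF iid, of 1]
    by (simp add: emeasure_eq_measure ennreal_mult' del: One_nat_def)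
  finally show ?thesis .
qed

text \<open>The tails of a claim sum to its mean, and the finite-horizon survival probabilities converge
  to the survival probability, so that \<open>survival_renewal\<close> applies.\<close>

lemma survival_prob_renewal:
  assumes iid: "iid_claims M Y f" and mean: "claim_mean M Y = ennreal \<mu>" and \<mu>: "0 \<le> \<mu>" "\<mu> \<le> 1"
  shows "1 - ruin_prob M Y u = (1 - \<mu>) + (\<Sum>j<u. claim_tail f j * (1 - ruin_prob M Y (u - j)))"
proof -
  interpret claim_distribution f using iid by (rule iid_claims_distribution)
  have "(\<lambda>j. ennreal (claim_tail f j)) sums ennreal \<mu>"
    using summable_sums[OF summableI, of "\<lambda>j. ennreal (claim_tail f j)"]
    by (simp only: claim_mean_eq_sum_tails[OF iid, symmetric] mean)
  then have "claim_tail f sums \<mu>"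
    by (subst (asm) sums_ennreal) (use \<mu> claim_tail_nonneg in auto)
  then show ?thesis
    using survival_renewal[OF survive_tendsto_survival[OF iid], of \<mu> u] \<mu> by simp
qed

section \<open>Negative binomial identities\<close>

text \<open>Both sides are the coefficient of \<open>X ^ r\<close> in \<open>1 / (1 - X) ^ (m + l + 2)\<close>, factored on the left as
  \<open>1 / (1 - X) ^ (m + 1)\<close> times \<open>1 / (1 - X) ^ (l + 1)\<close>. The induction applies Pascal's rule to the second
  factor.\<close>

lemma sum_choose_convolution:
  "(\<Sum>j\<le>r. (j + m choose m) * (r - j + l choose l)) = (r + m + l + 1 choose (m + l + 1))"
proof (induction l arbitrary: r)
  case 0
  have "(\<Sum>j\<le>r. j + m choose m) = (\<Sum>j\<le>r. m + j choose j)"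
    by (intro sum.cong refl) (subst binomial_symmetric, auto simp: add.commute)
  also have "\<dots> = Suc (m + r) choose r"
    by (rule sum_choose_lower)
  also have "\<dots> = Suc (m + r) choose Suc m"
    by (subst binomial_symmetric) auto
  finally show ?case by (simp add: add.commute)
next
  case (Suc l)
  show ?case
  proof (induction r)
    case (Suc r)
    have "(\<Sum>j\<le>Suc r. (j + m choose m) * (Suc r - j + Suc l choose Suc l)) =
        (\<Sum>j\<le>Suc r. (j + m choose m) * (Suc r - j + l choose l)) +
        (\<Sum>j\<le>Suc r. (j + m choose m) * (Suc r - j + l choose Suc l))"
      by (simp only: add_Suc_right binomial_Suc_Suc distrib_left sum.distrib)
    also have "(\<Sum>j\<le>Suc r. (j + m choose m) * (Suc r - j + l choose Suc l)) =
        (\<Sum>j\<le>r. (j + m choose m) * (r - j + Suc l choose Suc l))"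
      by (simp add: Suc_diff_le)
    finally show ?case
      unfolding Suc.IH \<open>\<And>r. (\<Sum>j\<le>r. (j + m choose m) * (r - j + l choose l)) = _\<close>
      by simp
  qed simp
qed

lemma pmf_neg_binomial_Suc:
  assumes "p \<in> {0<..<1}"
  shows "pmf (neg_binomial_pmf (Suc j) p) m = real (j + m choose m) * p ^ Suc j * (1 - p) ^ m"
  using assms by (subst pmf_neg_binomial) (auto simp: add.commute)

lemma neg_binomial_tail_step:
  assumes "p \<in> {0<..<1}"
  shows "(\<Sum>x\<le>j. pmf (neg_binomial_pmf k p) x) - (\<Sum>x\<le>j. pmf (neg_binomial_pmf (Suc k) p) x) =
    pmf (neg_binomial_pmf (Suc j) (1 - p)) k"
proof -
  have nb: "pmf (neg_binomial_pmf i p) x = real (x + i - 1 choose x) * p ^ i * (1 - p) ^ x" for i x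
    using assms by (intro pmf_neg_binomial) auto
  have "(\<Sum>x\<le>j. pmf (neg_binomial_pmf k p) x) - (\<Sum>x\<le>j. pmf (neg_binomial_pmf (Suc k) p) x) =
      real (j + k choose j) * (1 - p) ^ Suc j * p ^ k"
  proof (induction j)
    case 0
    show ?case by (simp add: nb algebra_simps)
  next
    case (Suc j)
    have pascal: "real (Suc j + k choose Suc j) = real (j + k choose j) + real (j + k choose Suc j)"
      by simp
    have "(\<Sum>x\<le>Suc j. pmf (neg_binomial_pmf k p) x) - (\<Sum>x\<le>Suc j. pmf (neg_binomial_pmf (Suc k) p) x) =
        real (j + k choose j) * (1 - p) ^ Suc j * p ^ k + real (j + k choose Suc j) * p ^ k * (1 - p) ^ Suc j
        - real (Suc j + k choose Suc j) * p ^ Suc k * (1 - p) ^ Suc j"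
      using Suc by (simp add: nb)
    also have "\<dots> = real (Suc j + k choose Suc j) * (1 - p) ^ Suc (Suc j) * p ^ k"
      unfolding pascal by (simp add: algebra_simps)
    finally show ?case .
  qed
  moreover have "j + k choose j = j + k choose k"
    by (subst binomial_symmetric) auto
  ultimately show ?thesis
    using assms by (simp add: pmf_neg_binomial_Suc)
qed

text \<open>In a sequence of coin flips with heads probability \<open>p\<close>, more than \<open>j\<close> tails precede the \<open>k\<close>-th
  head iff fewer than \<open>k\<close> heads precede the \<open>(j + 1)\<close>-st tail. This exchange of heads and tails is
  where the parameter \<open>1 - p\<close> of the variable \<open>Z\<close> comes from.\<close>

lemma neg_binomial_tail:
  assumes "p \<in> {0<..<1}"
  shows "claim_tail (pmf (neg_binomial_pmf k p)) j = (\<Sum>m<k. pmf (neg_binomial_pmf (Suc j) (1 - p)) m)"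
proof (induction k)
  case 0
  have "(\<Sum>x\<le>j. pmf (neg_binomial_pmf 0 p) x) = 1"
    by (induction j) (auto simp: pmf_return)
  then show ?case by (simp add: claim_tail_def)
next
  case (Suc k)
  then show ?case
    using neg_binomial_tail_step[OF assms, of k j] by (simp add: claim_tail_def)
qed

text \<open>Here \<open>neg_binomial_pmf u \<rho>\<close> is the law of the number of failures before the \<open>u\<close>-th success. If there are
  \<open>m + l + 1\<close> of them, the failure number \<open>m + 1\<close> comes after exactly \<open>j\<close> successes for some \<open>j < u\<close>.
  Splitting there leaves \<open>m\<close> failures and \<open>j\<close> successes before it, and \<open>l\<close> failures and \<open>u - j\<close>
  successes after it, the last flip being a success. Replacing the failure at the split by a
  success turns the first part into an outcome for \<open>Suc j\<close> successes; this replacement accounts for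
  the factor \<open>(1 - \<rho>) / \<rho>\<close>.\<close>

lemma neg_binomial_convolution:
  assumes "\<rho> \<in> {0<..<1}"
  shows "pmf (neg_binomial_pmf u \<rho>) (Suc (m + l)) =
    (1 - \<rho>) / \<rho> * (\<Sum>j<u. pmf (neg_binomial_pmf (Suc j) \<rho>) m * pmf (neg_binomial_pmf (u - j) \<rho>) l)"
proof (cases u)
  case 0
  then show ?thesis by (simp add: pmf_return)
next
  case (Suc r)
  have "(\<Sum>j<u. pmf (neg_binomial_pmf (Suc j) \<rho>) m * pmf (neg_binomial_pmf (u - j) \<rho>) l) =
      (\<Sum>j\<le>r. real ((j + m choose m) * (r - j + l choose l)) * (\<rho> ^ Suc (Suc r) * (1 - \<rho>) ^ (m + l)))"
    unfolding Suc lessThan_Suc_atMost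
  proof (intro sum.cong refl)
    fix j assume "j \<in> {..r}"
    then have "Suc r - j = Suc (r - j)" and "\<rho> ^ Suc (Suc r) = \<rho> ^ Suc j * \<rho> ^ Suc (r - j)"
      by (auto simp flip: power_add)
    then show "pmf (neg_binomial_pmf (Suc j) \<rho>) m * pmf (neg_binomial_pmf (Suc r - j) \<rho>) l =
        real ((j + m choose m) * (r - j + l choose l)) * (\<rho> ^ Suc (Suc r) * (1 - \<rho>) ^ (m + l))"
      using assms by (simp only: pmf_neg_binomial_Suc power_add of_nat_mult mult_ac)
  qed
  also have "\<dots> = real (r + m + l + 1 choose (m + l + 1)) * (\<rho> ^ Suc (Suc r) * (1 - \<rho>) ^ (m + l))"
    by (simp only: sum_choose_convolution flip: sum_distrib_right of_nat_sum)
  finally show ?thesis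
    using assms by (simp add: Suc pmf_neg_binomial_Suc add_ac)
qed

section \<open>Averages of renewal sequences\<close>

lemma pmf_nat_sums_expectation:
  fixes g :: "nat \<Rightarrow> real"
  assumes g: "\<And>k. \<bar>g k\<bar> \<le> 1"
  shows "integrable (measure_pmf P) g"
    and "(\<lambda>k. g k * pmf P k) sums measure_pmf.expectation P g"
proof -
  show int: "integrable (measure_pmf P) g"
    using g by (intro measure_pmf.integrable_const_bound[where B = 1]) auto
  have "integrable (count_space UNIV) (\<lambda>k. pmf P k *\<^sub>R g k)"
    using int unfolding measure_pmf_eq_density by (subst (asm) integrable_density) auto
  from sums_integral_count_space_nat[OF this]
  have "(\<lambda>k. pmf P k *\<^sub>R g k) sums integral\<^sup>L (count_space UNIV) (\<lambda>k. pmf P k *\<^sub>R g k)" .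
  also have "integral\<^sup>L (count_space UNIV) (\<lambda>k. pmf P k *\<^sub>R g k) = measure_pmf.expectation P g"
    unfolding measure_pmf_eq_density by (subst integral_density) auto
  finally show "(\<lambda>k. g k * pmf P k) sums measure_pmf.expectation P g"
    by (simp add: mult.commute)
qed

lemma pmf_nat_sums: "pmf (P :: nat pmf) sums 1"
  using pmf_nat_sums_expectation(2)[of "\<lambda>_. 1" P] by simp

text \<open>Averaging a renewal sequence over negative binomial indices gives a renewal sequence. By
  \<open>neg_binomial_convolution\<close> the \<open>k\<close>-th term of the average of \<open>\<Sum>i<k. a i * D (k - 1 - i)\<close> is a
  finite sum, over \<open>j < u\<close>, of coefficients of Cauchy products; each product has the sum
  \<open>T j * \<Phi> (u - j)\<close>.\<close>

lemma neg_binomial_average_renewal: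
  fixes a D :: "nat \<Rightarrow> real"
  assumes \<rho>: "\<rho> \<in> {0<..<1}"
    and a_nonneg: "\<And>i. 0 \<le> a i"
    and D_bounds: "\<And>k. 0 \<le> D k" "\<And>k. D k \<le> 1"
    and D: "\<And>k. D k = (1 - \<mu>) + (\<Sum>i<k. a i * D (k - Suc i))"
    and T: "\<And>j. (\<lambda>m. (1 - \<rho>) / \<rho> * a m * pmf (neg_binomial_pmf (Suc j) \<rho>) m) sums T j"
    and \<Phi>: "\<And>u. (\<lambda>k. D k * pmf (neg_binomial_pmf u \<rho>) k) sums \<Phi> u"
  shows "\<Phi> u = (1 - \<mu>) + (\<Sum>j<u. T j * \<Phi> (u - j))"
proof -
  let ?c = "(1 - \<rho>) / \<rho>"
  let ?P = "\<lambda>u. pmf (neg_binomial_pmf u \<rho>)"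
  let ?A = "\<lambda>j m. ?c * a m * ?P (Suc j) m"
  let ?B = "\<lambda>j l. D l * ?P (u - j) l"
  have "(\<lambda>k. \<Sum>i\<le>k. ?A j i * ?B j (k - i)) sums (T j * \<Phi> (u - j))" for j
  proof -
    have "norm (?A j m) = ?A j m" "norm (?B j m) = ?B j m" for m
      using \<rho> a_nonneg[of m] D_bounds(1)[of m] by (simp_all add: abs_mult)
    then have "summable (\<lambda>m. norm (?A j m))" "summable (\<lambda>m. norm (?B j m))"
      using sums_summable[OF T[of j]] sums_summable[OF \<Phi>[of "u - j"]] by (simp_all only:)
    from Cauchy_product_sums[OF this] show ?thesis
      by (simp only: sums_unique[OF T, symmetric] sums_unique[OF \<Phi>, symmetric])
  qed
  then have "(\<lambda>k. \<Sum>j<u. \<Sum>i\<le>k. ?A j i * ?B j (k - i)) sums (\<Sum>j<u. T j * \<Phi> (u - j))"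
    by (intro sums_sum)
  moreover have "(\<Sum>j<u. \<Sum>i\<le>k. ?A j i * ?B j (k - i)) = (D (Suc k) - (1 - \<mu>)) * ?P u (Suc k)" for k
  proof -
    have "(\<Sum>j<u. \<Sum>i\<le>k. ?A j i * ?B j (k - i)) =
        (\<Sum>i\<le>k. \<Sum>j<u. ?A j i * ?B j (k - i))"
      by (rule sum.swap)
    also have "\<dots> = (\<Sum>i\<le>k. a i * D (k - i) * (?c * (\<Sum>j<u. ?P (Suc j) i * ?P (u - j) (k - i))))"
      by (simp only: sum_distrib_left mult_ac)
    also have "\<dots> = (\<Sum>i\<le>k. a i * D (k - i) * ?P u (Suc k))"
    proof (intro sum.cong refl)
      fix i assume "i \<in> {..k}"
      then have "?P u (Suc k) = ?c * (\<Sum>j<u. ?P (Suc j) i * ?P (u - j) (k - i))"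
        using neg_binomial_convolution[OF \<rho>, of u i "k - i"] by simp
      then show "a i * D (k - i) * (?c * (\<Sum>j<u. ?P (Suc j) i * ?P (u - j) (k - i))) =
          a i * D (k - i) * ?P u (Suc k)"
        by (simp only:)
    qed
    also have "\<dots> = (D (Suc k) - (1 - \<mu>)) * ?P u (Suc k)"
      using D[of "Suc k"] by (simp add: lessThan_Suc_atMost flip: sum_distrib_right)
    finally show ?thesis .
  qed
  ultimately have "(\<lambda>k. (D (Suc k) - (1 - \<mu>)) * ?P u (Suc k)) sums (\<Sum>j<u. T j * \<Phi> (u - j))"
    by simp
  moreover have "(D 0 - (1 - \<mu>)) * ?P u 0 = 0"
    using D[of 0] by simp
  ultimately have "(\<lambda>k. (D k - (1 - \<mu>)) * ?P u k) sums (\<Sum>j<u. T j * \<Phi> (u - j))"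
    using sums_Suc[of "\<lambda>k. (D k - (1 - \<mu>)) * ?P u k"] by fastforce
  moreover have "(\<lambda>k. D k * ?P u k - (1 - \<mu>) * ?P u k) sums (\<Phi> u - (1 - \<mu>) * 1)"
    by (intro sums_diff sums_mult \<Phi> pmf_nat_sums)
  ultimately have "\<Phi> u - (1 - \<mu>) * 1 = (\<Sum>j<u. T j * \<Phi> (u - j))"
    by (simp only: left_diff_distrib) (rule sums_unique2)
  then show ?thesis by simp
qed

lemma renewal_sequence_bounds:
  fixes a D :: "nat \<Rightarrow> real"
  assumes a_nonneg: "\<And>i. 0 \<le> a i" and a: "a sums \<mu>" and "\<mu> \<le> 1"
    and D: "\<And>k. D k = (1 - \<mu>) + (\<Sum>i<k. a i * D (k - Suc i))"
  shows "0 \<le> D k" and "D k \<le> 1"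
proof -
  have "0 \<le> D k \<and> D k \<le> 1"
  proof (induction k rule: less_induct)
    case (less k)
    have "(\<Sum>i<k. a i * D (k - Suc i)) \<le> (\<Sum>i<k. a i * 1)"
      using less by (intro sum_mono mult_left_mono a_nonneg) auto
    also have "\<dots> \<le> \<mu>"
      using sum_le_suminf[of a "{..<k}"] a a_nonneg by (auto simp: sums_iff)
    finally have "D k \<le> 1"
      using D[of k] by linarith
    moreover have "0 \<le> (\<Sum>i<k. a i * D (k - Suc i))"
      using less by (intro sum_nonneg mult_nonneg_nonneg a_nonneg) auto
    then have "0 \<le> D k"
      using D[of k] \<open>\<mu> \<le> 1\<close> by linarith
    ultimately show ?case by simp
  qed
  then show "0 \<le> D k" and "D k \<le> 1" by auto
qed

text \<open>With \<open>a i = survival F (i / n) / n\<close> the normalization in \<open>f_Ne\<close> cancels against the factor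
  \<open>C_bar F n 0\<close>, and \<open>1 - C_bar\<close> satisfies a renewal equation of the same shape as the survival
  probability. If the sum \<open>\<mu>\<close> is \<open>0\<close>, every \<open>a i\<close> vanishes and the division by zero is harmless.\<close>

lemma C_bar_renewal:
  assumes "1 \<le> n" and nonneg: "\<And>j. 0 \<le> survival F (real j / real n)"
    and sums: "(\<lambda>j. survival F (real j / real n) / real n) sums \<mu>"
  shows "1 - C_bar F n k = (1 - \<mu>) +
      (\<Sum>i<k. survival F (real i / real n) / real n * (1 - C_bar F n (k - Suc i)))"
proof -
  define a where "a = (\<lambda>j. survival F (real j / real n) / real n)"
  have a: "a sums \<mu>" "0 \<le> a j" for j
    using sums nonneg by (auto simp: a_def)
  have C0: "C_bar F n 0 = \<mu>"
    using sums by (simp add: sums_iff)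
  have total: "(\<Sum>j. survival F (real j / real n)) = real n * \<mu>"
    using sums_mult[OF sums, of "real n"] \<open>1 \<le> n\<close> by (simp add: sums_iff)
  have weight: "\<mu> * f_Ne F n (Suc i) = a i" for i
  proof (cases "\<mu> = 0")
    case True
    then have "a i = 0"
      using a suminf_eq_zero_iff[of a] by (auto simp: sums_iff)
    then show ?thesis using True by simp
  next
    case False
    then show ?thesis
      using \<open>1 \<le> n\<close> by (simp add: f_Ne_def total a_def)
  qed
  have tail: "\<mu> * F_Ne_bar F n k = \<mu> - (\<Sum>i<k. a i)" for k
  proof (cases "\<mu> = 0")
    case True
    then have "a i = 0" for i
      using a suminf_eq_zero_iff[of a] by (auto simp: sums_iff)
    then show ?thesis using True by simp
  next
    case False
    have "f_Ne F n (Suc i) = a i / \<mu>" for i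
      using weight[of i] False by (simp add: field_simps)
    then have "F_Ne_bar F n k = (\<Sum>i. a (i + k) / \<mu>)"
      by (simp add: F_Ne_bar_def add.commute)
    also have "\<dots> = (\<mu> - (\<Sum>i<k. a i)) / \<mu>"
      using sums_divide[OF sums_split_initial_segment[OF a(1), of k], of \<mu>] by (simp add: sums_iff)
    finally show ?thesis using False by simp
  qed
  have "1 - C_bar F n k = (1 - \<mu>) + (\<Sum>i<k. a i * (1 - C_bar F n (k - Suc i)))"
  proof (cases k)
    case 0
    then show ?thesis by (simp only: C0) simp
  next
    case (Suc l)
    have "(\<Sum>i=1..Suc l. f_Ne F n i * C_bar F n (Suc l - i)) =
        (\<Sum>i<Suc l. f_Ne F n (Suc i) * C_bar F n (l - i))"
      unfolding One_nat_def sum.shift_bounds_cl_Suc_ivl by (simp add: atMost_atLeast0[symmetric] lessThan_Suc_atMost)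
    then have "C_bar F n k = (\<Sum>i<Suc l. \<mu> * f_Ne F n (Suc i) * C_bar F n (l - i)) + \<mu> * F_Ne_bar F n (Suc l)"
      unfolding Suc C_bar.simps(2) C0 by (simp only: distrib_left sum_distrib_left mult.assoc)
    also have "\<dots> = (\<Sum>i<k. a i * C_bar F n (k - Suc i)) + (\<mu> - (\<Sum>i<k. a i))"
      unfolding weight tail by (simp add: Suc)
    finally show ?thesis
      by (simp add: right_diff_distrib sum_subtractf)
  qed
  then show "1 - C_bar F n k = (1 - \<mu>) +
      (\<Sum>i<k. survival F (real i / real n) / real n * (1 - C_bar F n (k - Suc i)))"
    by (simp add: a_def)
qed

section \<open>Poisson limit of negative binomial distributions\<close>

lemma pmf_neg_binomial_pochhammer:
  assumes "p \<in> {0<..1}"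
  shows "pmf (neg_binomial_pmf k p) x = (\<Prod>i<x. (real k + real i) * (1 - p)) / fact x * p ^ k"
  using assms
  by (simp add: pmf_neg_binomial' gbinomial_pochhammer pochhammer_prod prod.distrib atLeast0LessThan
      flip: power_add mult_2)

text \<open>The success probability is \<open>1 - 1 / (n + 1)\<close> and the number of successes is about \<open>l * n\<close>, so the
  number of failures obeys the law of rare events. The pochhammer form of the binomial coefficient
  makes each of its \<open>x\<close> factors, times \<open>1 / (n + 1)\<close>, converge to \<open>l\<close>.\<close>

lemma neg_binomial_tendsto_poisson:
  assumes k: "(\<lambda>n. real (k n) / real n) \<longlonglongrightarrow> l"
  shows "(\<lambda>n. pmf (neg_binomial_pmf (k n) (real n / (real n + 1))) x) \<longlonglongrightarrow> poisson_pf l x"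
proof -
  have factor: "(\<lambda>n. (real (k n) + real i) * (1 - real n / (real n + 1))) \<longlonglongrightarrow> l" for i
  proof -
    have "(\<lambda>n. real (k n) / real n * (real n / (real n + 1)) + real i * (1 - real n / (real n + 1))) \<longlonglongrightarrow>
        l * 1 + real i * 0"
      by (intro tendsto_add tendsto_mult k tendsto_const; real_asymp)
    moreover have "\<forall>\<^sub>F n in sequentially.
        real (k n) / real n * (real n / (real n + 1)) + real i * (1 - real n / (real n + 1)) =
        (real (k n) + real i) * (1 - real n / (real n + 1))"
      using eventually_gt_at_top[of 0]
    proof eventually_elim
      case (elim n)
      have q: "1 - real n / (real n + 1) = 1 / (real n + 1)"
        by (simp add: field_simps)
      have "real (k n) / real n * (real n / (real n + 1)) = real (k n) * (1 / (real n + 1))"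
        using elim by simp
      then show ?case
        unfolding q by (simp only: distrib_right)
    qed
    ultimately show ?thesis
      by (auto intro: Lim_transform_eventually)
  qed
  have "(\<lambda>n. exp (real (k n) / real n * (real n * ln (real n / (real n + 1))))) \<longlonglongrightarrow> exp (l * (- 1))"
    by (intro tendsto_exp tendsto_mult k) real_asymp
  moreover have "\<forall>\<^sub>F n in sequentially.
      exp (real (k n) / real n * (real n * ln (real n / (real n + 1)))) = (real n / (real n + 1)) ^ k n"
    using eventually_gt_at_top[of 0]
    by eventually_elim (simp add: exp_of_nat_mult)
  ultimately have "(\<lambda>n. (real n / (real n + 1)) ^ k n) \<longlonglongrightarrow> exp (l * (- 1))"
    by (rule Lim_transform_eventually)
  then have "(\<lambda>n. (\<Prod>i<x. (real (k n) + real i) * (1 - real n / (real n + 1))) / fact x *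
      (real n / (real n + 1)) ^ k n) \<longlonglongrightarrow> (\<Prod>i<x. l) / fact x * exp (l * (- 1))"
    by (intro tendsto_mult tendsto_divide tendsto_prod factor tendsto_const) auto
  moreover have "\<forall>\<^sub>F n in sequentially.
      (\<Prod>i<x. (real (k n) + real i) * (1 - real n / (real n + 1))) / fact x * (real n / (real n + 1)) ^ k n =
      pmf (neg_binomial_pmf (k n) (real n / (real n + 1))) x"
    using eventually_gt_at_top[of 0]
    by eventually_elim (subst pmf_neg_binomial_pochhammer, auto)
  ultimately show ?thesis
    unfolding poisson_pf_def
    by (simp add: Lim_transform_eventually mult.commute)
qed

lemma poisson_pf_nonneg: "0 \<le> l \<Longrightarrow> 0 \<le> poisson_pf l x"
  by (simp add: poisson_pf_def)

lemma poisson_pf_sums: "poisson_pf l sums 1"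
proof -
  have "(\<lambda>x. exp (- l) * (l ^ x /\<^sub>R fact x)) sums (exp (- l) * exp l)"
    by (intro sums_mult exp_converges)
  then show ?thesis
    by (simp add: poisson_pf_def[abs_def] divide_inverse mult_ac flip: exp_add)
qed

lemma poisson_pf_le_1: "0 \<le> l \<Longrightarrow> poisson_pf l x \<le> 1"
  using sum_le_suminf[of "poisson_pf l" "{x}"] poisson_pf_sums[of l] poisson_pf_nonneg[of l]
  by (auto simp: sums_iff)

lemma poisson_pf_mean_sums: "(\<lambda>x. real x * poisson_pf l x) sums l"
proof -
  have "real (Suc x) * poisson_pf l (Suc x) = l * poisson_pf l x" for x
    by (simp add: poisson_pf_def field_simps del: of_nat_Suc)
  then have "(\<lambda>x. real (Suc x) * poisson_pf l (Suc x)) sums l"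
    using sums_mult[OF poisson_pf_sums, of l l] by simp
  then show ?thesis
    by (subst (asm) sums_Suc_iff) simp
qed

lemma neg_binomial_mean_sums:
  assumes "p \<in> {0<..1}"
  shows "(\<Sum>x. ennreal (real x * pmf (neg_binomial_pmf k p) x)) = ennreal (real k * (1 - p) / p)"
proof -
  have "ennreal (real k * (1 - p) / p) = (\<integral>\<^sup>+x. ennreal (pmf (neg_binomial_pmf k p) x) * of_nat x \<partial>count_space UNIV)"
    using nn_integral_neg_binomial_pmf_real[OF assms, of k]
    by (simp add: nn_integral_measure_pmf)
  also have "\<dots> = (\<Sum>x. ennreal (pmf (neg_binomial_pmf k p) x) * of_nat x)"
    by (rule nn_integral_count_space_nat)
  finally show ?thesis
    by (simp add: ennreal_mult' ennreal_of_nat_eq_real_of_nat mult.commute)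
qed

section \<open>Claims driven by a mixing variable\<close>

context prob_space
begin

lemma nat_rv_expectation_sums:
  fixes g :: "nat \<Rightarrow> real"
  assumes [measurable]: "K \<in> M \<rightarrow>\<^sub>M count_space UNIV" and g: "\<And>k. \<bar>g k\<bar> \<le> 1"
  shows "(\<lambda>k. prob {\<omega> \<in> space M. K \<omega> = k} * g k) sums expectation (\<lambda>\<omega>. g (K \<omega>))"
proof -
  let ?E = "\<lambda>k. {\<omega> \<in> space M. K \<omega> = k}"
  let ?f = "\<lambda>k \<omega>. indicator (?E k) \<omega> * g k"
  have "(\<lambda>k. expectation (?f k)) sums expectation (\<lambda>\<omega>. \<Sum>k. ?f k \<omega>)"
  proof (rule sums_integral)
    show "integrable M (?f k)" for k
      by (intro integrable_mult_left) (simp add: emeasure_eq_measure)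
    have "summable (\<lambda>k. norm (?f k \<omega>))" for \<omega>
      by (rule summable_finite[of "{K \<omega>}"]) auto
    then show "AE \<omega> in M. summable (\<lambda>k. norm (?f k \<omega>))" by simp
    have "expectation (\<lambda>\<omega>. norm (?f k \<omega>)) = prob (?E k) * \<bar>g k\<bar>" for k
      by (simp add: abs_mult)
    moreover have "summable (\<lambda>k. prob (?E k) * \<bar>g k\<bar>)"
      using g by (intro summable_comparison_test'[OF sums_summable[OF nat_rv_prob_sums[of K]]])
                 (auto intro: mult_left_le)
    ultimately show "summable (\<lambda>k. expectation (\<lambda>\<omega>. norm (?f k \<omega>)))" by simp
  qed
  moreover have "expectation (?f k) = prob (?E k) * g k" for k
    by simp
  moreover have "(\<Sum>k. ?f k \<omega>) = g (K \<omega>)" if "\<omega> \<in> space M" for \<omega>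
    using that suminf_finite[of "{K \<omega>}" "\<lambda>k. ?f k \<omega>"] by simp
  then have "expectation (\<lambda>\<omega>. \<Sum>k. ?f k \<omega>) = expectation (\<lambda>\<omega>. g (K \<omega>))"
    by (intro Bochner_Integration.integral_cong refl)
  ultimately show ?thesis by simp
qed

lemma nat_rv_sum_below_expectation_sums:
  fixes c :: "nat \<Rightarrow> real"
  assumes [measurable]: "K \<in> M \<rightarrow>\<^sub>M count_space UNIV" and c: "\<And>m. 0 \<le> c m" "summable c"
  shows "(\<lambda>m. prob {\<omega> \<in> space M. m < K \<omega>} * c m) sums expectation (\<lambda>\<omega>. \<Sum>m<K \<omega>. c m)"
proof -
  let ?E = "\<lambda>m. {\<omega> \<in> space M. m < K \<omega>}"
  let ?f = "\<lambda>m \<omega>. indicator (?E m) \<omega> * c m"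
  have "(\<lambda>m. expectation (?f m)) sums expectation (\<lambda>\<omega>. \<Sum>m. ?f m \<omega>)"
  proof (rule sums_integral)
    show "integrable M (?f m)" for m
      by (intro integrable_mult_left) (simp add: emeasure_eq_measure)
    have "summable (\<lambda>m. norm (?f m \<omega>))" for \<omega>
      by (rule summable_finite[of "{..<K \<omega>}"]) (auto simp: indicator_def)
    then show "AE \<omega> in M. summable (\<lambda>m. norm (?f m \<omega>))" by simp
    have "expectation (\<lambda>\<omega>. norm (?f m \<omega>)) = prob (?E m) * c m" for m
      using c(1) by (simp add: abs_mult)
    moreover have "summable (\<lambda>m. prob (?E m) * c m)"
      using c(1) by (intro summable_comparison_test'[OF c(2)]) (auto intro: mult_left_le_one_le)
    ultimately show "summable (\<lambda>m. expectation (\<lambda>\<omega>. norm (?f m \<omega>)))" by simp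
  qed
  moreover have "expectation (?f m) = prob (?E m) * c m" for m
    by simp
  moreover have "(\<Sum>m. ?f m \<omega>) = (\<Sum>m<K \<omega>. c m)" if "\<omega> \<in> space M" for \<omega>
    using that by (subst suminf_finite[of "{..<K \<omega>}"]) auto
  then have "expectation (\<lambda>\<omega>. \<Sum>m. ?f m \<omega>) = expectation (\<lambda>\<omega>. \<Sum>m<K \<omega>. c m)"
    by (intro Bochner_Integration.integral_cong refl)
  ultimately show ?thesis by simp
qed

text \<open>The summand \<open>k = 0\<close> of the expectation is the point mass at \<open>0\<close>, weighted with the mass that
  the weights \<open>q 1, q 2, \<dots>\<close> leave over.\<close>

lemma nbm_pf_eq_expectation:
  assumes K[measurable]: "K \<in> M \<rightarrow>\<^sub>M count_space UNIV"
    and q: "\<And>k. q (Suc k) = prob {\<omega> \<in> space M. K \<omega> = Suc k}"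
  shows "nbm_pf q p x = expectation (\<lambda>\<omega>. pmf (neg_binomial_pmf (K \<omega>) p) x)"
proof -
  let ?P = "\<lambda>k. prob {\<omega> \<in> space M. K \<omega> = k}"
  let ?g = "\<lambda>k. pmf (neg_binomial_pmf k p) x"
  have "(\<lambda>k. ?P (Suc k)) sums (1 - ?P 0)"
    using nat_rv_prob_sums[OF K] by (subst sums_Suc_iff) simp
  moreover have "(\<lambda>k. ?P (Suc k) * ?g (Suc k)) sums (expectation (\<lambda>\<omega>. ?g (K \<omega>)) - ?P 0 * ?g 0)"
    using nat_rv_expectation_sums[OF K, of ?g] by (subst sums_Suc_iff) (simp add: pmf_le_1)
  ultimately show ?thesis
    unfolding nbm_pf_def q by (simp only: sums_iff) simp
qed

lemma mixture_mean:
  fixes g :: "'a \<Rightarrow> nat \<Rightarrow> real"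
  assumes [measurable]: "\<And>x. (\<lambda>\<omega>. g \<omega> x) \<in> borel_measurable M"
    and g: "AE \<omega> in M. \<forall>x. 0 \<le> g \<omega> x \<and> g \<omega> x \<le> 1"
  shows "(\<Sum>x. ennreal (real x * expectation (\<lambda>\<omega>. g \<omega> x))) =
    (\<integral>\<^sup>+\<omega>. (\<Sum>x. ennreal (real x * g \<omega> x)) \<partial>M)"
proof -
  have "ennreal (real x * expectation (\<lambda>\<omega>. g \<omega> x)) = (\<integral>\<^sup>+\<omega>. ennreal (real x * g \<omega> x) \<partial>M)" for x
  proof -
    have "integrable M (\<lambda>\<omega>. real x * g \<omega> x)"
      using g by (intro integrable_mult_right integrable_const_bound[where B = 1]) auto
    moreover have "AE \<omega> in M. 0 \<le> real x * g \<omega> x"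
      using g by eventually_elim simp
    ultimately show ?thesis
      by (subst nn_integral_eq_integral) auto
  qed
  then show ?thesis
    by (simp add: nn_integral_suminf)
qed

lemma claim_tail_expectation:
  fixes g :: "'a \<Rightarrow> nat \<Rightarrow> real"
  assumes "\<And>x. integrable M (\<lambda>\<omega>. g \<omega> x)"
  shows "claim_tail (\<lambda>x. expectation (\<lambda>\<omega>. g \<omega> x)) j = expectation (\<lambda>\<omega>. claim_tail (g \<omega>) j)"
  using assms by (simp add: claim_tail_def Bochner_Integration.integral_sum prob_space)

end

locale mixing_variable = prob_space M for M :: "'a measure" +
  fixes \<Lambda> :: "'a \<Rightarrow> real"
  assumes measurable_mixing [measurable]: "\<Lambda> \<in> borel_measurable M"
    and mixing_nonneg: "AE \<omega> in M. 0 \<le> \<Lambda> \<omega>"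
    and mixing_integrable: "integrable M \<Lambda>"
begin

text \<open>Rounding \<open>n * \<Lambda>\<close> up to an integer gives the number of successes of the negative binomial claims
  whose mixture approximates the mixed Poisson claims: \<open>grid n = k\<close> iff \<open>(k - 1) / n < \<Lambda> \<le> k / n\<close>
  for \<open>n, k \<ge> 1\<close>. Values \<open>\<Lambda> \<le> 0\<close> go to \<open>0\<close>.\<close>

definition grid :: "nat \<Rightarrow> 'a \<Rightarrow> nat" where
  "grid n \<omega> = nat \<lceil>real n * \<Lambda> \<omega>\<rceil>"

definition nbm_claim_pf :: "nat \<Rightarrow> nat \<Rightarrow> real" where
  "nbm_claim_pf n x = expectation (\<lambda>\<omega>. pmf (neg_binomial_pmf (grid n \<omega>) (real n / (real n + 1))) x)"

lemma measurable_grid [measurable]: "grid n \<in> M \<rightarrow>\<^sub>M count_space UNIV"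
  unfolding grid_def by measurable

lemma less_grid_iff: "m < grid n \<omega> \<longleftrightarrow> real m < real n * \<Lambda> \<omega>"
  by (simp add: grid_def zless_nat_eq_int_zless less_ceiling_iff)

lemma survival_eq_prob_grid:
  assumes "1 \<le> n"
  shows "survival (cdf (distr M borel \<Lambda>)) (real m / real n) = prob {\<omega> \<in> space M. m < grid n \<omega>}"
proof -
  have "cdf (distr M borel \<Lambda>) (real m / real n) = prob {\<omega> \<in> space M. \<Lambda> \<omega> \<le> real m / real n}"
    unfolding cdf_def by (subst measure_distr) (auto intro!: arg_cong[where f = prob])
  moreover have "prob (space M - {\<omega> \<in> space M. \<Lambda> \<omega> \<le> real m / real n}) =
      1 - prob {\<omega> \<in> space M. \<Lambda> \<omega> \<le> real m / real n}"
    by (rule prob_compl) measurable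
  moreover have "space M - {\<omega> \<in> space M. \<Lambda> \<omega> \<le> real m / real n} = {\<omega> \<in> space M. m < grid n \<omega>}"
    using assms by (auto simp: less_grid_iff field_simps)
  ultimately show ?thesis by (simp add: survival_def)
qed

lemma nbm_weight_eq_prob_grid:
  assumes "1 \<le> n"
  shows "nbm_weight (cdf (distr M borel \<Lambda>)) n (Suc k) = prob {\<omega> \<in> space M. grid n \<omega> = Suc k}"
proof -
  let ?S = "\<lambda>k. {\<omega> \<in> space M. k < grid n \<omega>}"
  have "nbm_weight (cdf (distr M borel \<Lambda>)) n (Suc k) = prob (?S k) - prob (?S (Suc k))"
    unfolding survival_eq_prob_grid[OF assms, symmetric] by (simp add: nbm_weight_def survival_def)
  also have "\<dots> = prob (?S k - ?S (Suc k))"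
    by (rule finite_measure_Diff[symmetric]) auto
  also have "?S k - ?S (Suc k) = {\<omega> \<in> space M. grid n \<omega> = Suc k}"
    by auto
  finally show ?thesis .
qed

lemma nbm_pf_eq_nbm_claim_pf:
  assumes "1 \<le> n"
  shows "nbm_pf (nbm_weight (cdf (distr M borel \<Lambda>)) n) (real n / (real n + 1)) = nbm_claim_pf n"
  unfolding nbm_claim_pf_def[abs_def]
  using nbm_pf_eq_expectation[OF measurable_grid nbm_weight_eq_prob_grid[OF assms]] by blast

lemma integrable_neg_binomial_grid:
  "integrable M (\<lambda>\<omega>. pmf (neg_binomial_pmf (grid n \<omega>) p) x)"
  by (intro integrable_const_bound[where B = 1]) (auto simp: pmf_le_1)

text \<open>Taking expectations in \<open>neg_binomial_tail\<close>: the tail of a claim is \<open>P (Z < grid n)\<close> for an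
  independent \<open>Z\<close> with distribution \<open>NegBin (j + 1, 1 / (n + 1))\<close>.\<close>

lemma nbm_claim_tail_sums:
  assumes "1 \<le> n"
  shows "(\<lambda>m. survival (cdf (distr M borel \<Lambda>)) (real m / real n) *
      pmf (neg_binomial_pmf (Suc j) (1 / (1 + real n))) m) sums claim_tail (nbm_claim_pf n) j"
proof -
  define p where "p = real n / (real n + 1)"
  have p: "p \<in> {0<..<1}" and \<rho>: "1 / (1 + real n) = 1 - p"
    using assms by (auto simp: p_def field_simps)
  have "claim_tail (nbm_claim_pf n) j = expectation (\<lambda>\<omega>. claim_tail (pmf (neg_binomial_pmf (grid n \<omega>) p)) j)"
    unfolding nbm_claim_pf_def[abs_def] p_def
    by (rule claim_tail_expectation) (rule integrable_neg_binomial_grid)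
  also have "\<dots> = expectation (\<lambda>\<omega>. \<Sum>m<grid n \<omega>. pmf (neg_binomial_pmf (Suc j) (1 - p)) m)"
    by (simp only: neg_binomial_tail[OF p])
  finally show ?thesis
    unfolding \<rho> survival_eq_prob_grid[OF assms]
    using nat_rv_sum_below_expectation_sums[OF measurable_grid, of "pmf (neg_binomial_pmf (Suc j) (1 - p))" n]
      sums_summable[OF pmf_nat_sums, of "neg_binomial_pmf (Suc j) (1 - p)"] by simp
qed

lemma grid_bounds:
  assumes "0 \<le> \<Lambda> \<omega>"
  shows "real n * \<Lambda> \<omega> \<le> real (grid n \<omega>)" and "real (grid n \<omega>) \<le> real n * \<Lambda> \<omega> + 1"
proof -
  have "real (grid n \<omega>) = of_int \<lceil>real n * \<Lambda> \<omega>\<rceil>"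
    using assms by (simp add: grid_def)
  then show "real n * \<Lambda> \<omega> \<le> real (grid n \<omega>)" and "real (grid n \<omega>) \<le> real n * \<Lambda> \<omega> + 1"
    by (simp_all add: of_int_ceiling_le_add_one)
qed

lemma grid_quotient_tendsto:
  assumes "0 \<le> \<Lambda> \<omega>"
  shows "(\<lambda>n. real (grid n \<omega>) / real n) \<longlonglongrightarrow> \<Lambda> \<omega>"
proof (rule tendsto_sandwich)
  show "\<forall>\<^sub>F n in sequentially. \<Lambda> \<omega> \<le> real (grid n \<omega>) / real n"
    using eventually_gt_at_top[of 0]
    by eventually_elim (use grid_bounds[OF assms] in \<open>simp add: field_simps\<close>)
  show "\<forall>\<^sub>F n in sequentially. real (grid n \<omega>) / real n \<le> \<Lambda> \<omega> + 1 / real n"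
    using eventually_gt_at_top[of 0]
    by eventually_elim (use grid_bounds[OF assms] in \<open>simp add: field_simps\<close>)
  show "(\<lambda>n. \<Lambda> \<omega> + 1 / real n) \<longlonglongrightarrow> \<Lambda> \<omega>"
    by real_asymp
qed simp

lemma integrable_grid: "integrable M (\<lambda>\<omega>. real (grid n \<omega>))"
proof (rule Bochner_Integration.integrable_bound)
  show "integrable M (\<lambda>\<omega>. real n * \<Lambda> \<omega> + 1)"
    using mixing_integrable by simp
  show "AE \<omega> in M. norm (real (grid n \<omega>)) \<le> norm (real n * \<Lambda> \<omega> + 1)"
    using mixing_nonneg
  proof eventually_elim
    case (elim \<omega>)
    then show ?case using grid_bounds(2)[OF elim, of n] by simp
  qed
qed simp

lemma expectation_grid_tendsto:
  "(\<lambda>n. expectation (\<lambda>\<omega>. real (grid n \<omega>)) / real n) \<longlonglongrightarrow> expectation \<Lambda>"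
proof -
  have "(\<lambda>n. expectation (\<lambda>\<omega>. real (grid n \<omega>) / real n)) \<longlonglongrightarrow> expectation \<Lambda>"
  proof (rule integral_dominated_convergence[where w = "\<lambda>\<omega>. \<Lambda> \<omega> + 1"])
    show "integrable M (\<lambda>\<omega>. \<Lambda> \<omega> + 1)"
      using mixing_integrable by simp
    show "AE \<omega> in M. (\<lambda>n. real (grid n \<omega>) / real n) \<longlonglongrightarrow> \<Lambda> \<omega>"
      using mixing_nonneg by eventually_elim (rule grid_quotient_tendsto)
    show "AE \<omega> in M. norm (real (grid n \<omega>) / real n) \<le> \<Lambda> \<omega> + 1" for n
      using mixing_nonneg
    proof eventually_elim
      case (elim \<omega>)
      show ?case
      proof (cases "n = 0")
        case False
        then have "real (grid n \<omega>) \<le> real n * \<Lambda> \<omega> + real n"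
          using grid_bounds(2)[OF elim, of n] by simp
        then show ?thesis using False by (simp add: field_simps)
      qed (use elim in simp)
    qed
  qed auto
  then show ?thesis by simp
qed

text \<open>Both sides are the mean of a claim: the left one is \<open>C_bar F n 0\<close>, the right one is a mixture of
  the means \<open>k / n\<close> of the negative binomial components.\<close>

lemma survival_sums_expectation_grid:
  assumes "1 \<le> n"
  shows "(\<lambda>j. survival (cdf (distr M borel \<Lambda>)) (real j / real n) / real n) sums
    (expectation (\<lambda>\<omega>. real (grid n \<omega>)) / real n)"
proof -
  have "(\<Sum>j. ennreal (prob {\<omega> \<in> space M. j < grid n \<omega>})) = (\<integral>\<^sup>+\<omega>. of_nat (grid n \<omega>) \<partial>M)"
    unfolding emeasure_eq_measure[symmetric] by (rule nn_integral_nat_function[symmetric]) measurable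
  also have "\<dots> = ennreal (expectation (\<lambda>\<omega>. real (grid n \<omega>)))"
    unfolding ennreal_of_nat_eq_real_of_nat by (rule nn_integral_eq_integral[OF integrable_grid]) simp
  finally have "(\<lambda>j. ennreal (prob {\<omega> \<in> space M. j < grid n \<omega>})) sums
      ennreal (expectation (\<lambda>\<omega>. real (grid n \<omega>)))"
    using summable_sums[OF summableI, of "\<lambda>j. ennreal (prob {\<omega> \<in> space M. j < grid n \<omega>})"]
    by simp
  then have "(\<lambda>j. prob {\<omega> \<in> space M. j < grid n \<omega>}) sums expectation (\<lambda>\<omega>. real (grid n \<omega>))"
    by (subst (asm) sums_ennreal) auto
  then show ?thesis
    unfolding survival_eq_prob_grid[OF assms] by (rule sums_divide)
qed

lemma nbm_claim_mean:
  assumes "1 \<le> n"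
  shows "(\<Sum>x. ennreal (real x * nbm_claim_pf n x)) = ennreal (expectation (\<lambda>\<omega>. real (grid n \<omega>)) / real n)"
proof -
  define p where "p = real n / (real n + 1)"
  have p: "p \<in> {0<..1}" and "1 - p = 1 / (real n + 1)"
    using assms by (auto simp: p_def field_simps)
  then have ratio: "real k * (1 - p) / p = real k / real n" for k
    by (simp add: p_def)
  have "(\<Sum>x. ennreal (real x * nbm_claim_pf n x)) =
      (\<integral>\<^sup>+\<omega>. (\<Sum>x. ennreal (real x * pmf (neg_binomial_pmf (grid n \<omega>) p) x)) \<partial>M)"
    unfolding nbm_claim_pf_def p_def by (rule mixture_mean) (auto simp: pmf_le_1)
  also have "\<dots> = (\<integral>\<^sup>+\<omega>. ennreal (real (grid n \<omega>) / real n) \<partial>M)"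
    by (simp only: neg_binomial_mean_sums[OF p] ratio)
  also have "\<dots> = ennreal (expectation (\<lambda>\<omega>. real (grid n \<omega>) / real n))"
    using integrable_grid by (intro nn_integral_eq_integral) auto
  finally show ?thesis by simp
qed

lemma nbm_claim_pf_0_pos: "1 \<le> n \<Longrightarrow> 0 < nbm_claim_pf n 0"
  unfolding nbm_claim_pf_def
  by (intro expectation_greater integrable_neg_binomial_grid) (simp add: pmf_neg_binomial)

lemma mixed_poisson_pf_eq_expectation:
  "mixed_poisson_pf (distr M borel \<Lambda>) x = expectation (\<lambda>\<omega>. poisson_pf (\<Lambda> \<omega>) x)"
  unfolding mixed_poisson_pf_def poisson_pf_def by (rule integral_distr) measurable

lemma measurable_poisson_pf_mixing [measurable]:
  "(\<lambda>\<omega>. poisson_pf (\<Lambda> \<omega>) x) \<in> borel_measurable M"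
  unfolding poisson_pf_def by measurable

lemma poisson_pf_mixing_bounds:
  "AE \<omega> in M. \<forall>x. 0 \<le> poisson_pf (\<Lambda> \<omega>) x \<and> poisson_pf (\<Lambda> \<omega>) x \<le> 1"
  using mixing_nonneg by eventually_elim (simp add: poisson_pf_nonneg poisson_pf_le_1)

lemma mixed_poisson_pf_0_pos: "0 < mixed_poisson_pf (distr M borel \<Lambda>) 0"
  unfolding mixed_poisson_pf_eq_expectation
proof (rule expectation_greater)
  show "integrable M (\<lambda>\<omega>. poisson_pf (\<Lambda> \<omega>) 0)"
    using poisson_pf_mixing_bounds by (intro integrable_const_bound[where B = 1]) auto
qed (simp add: poisson_pf_def)

lemma mixed_poisson_mean:
  "(\<Sum>x. ennreal (real x * mixed_poisson_pf (distr M borel \<Lambda>) x)) = ennreal (expectation \<Lambda>)"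
proof -
  have "(\<Sum>x. ennreal (real x * mixed_poisson_pf (distr M borel \<Lambda>) x)) =
      (\<integral>\<^sup>+\<omega>. (\<Sum>x. ennreal (real x * poisson_pf (\<Lambda> \<omega>) x)) \<partial>M)"
    unfolding mixed_poisson_pf_eq_expectation
    by (rule mixture_mean[OF measurable_poisson_pf_mixing poisson_pf_mixing_bounds])
  also have "\<dots> = (\<integral>\<^sup>+\<omega>. ennreal (\<Lambda> \<omega>) \<partial>M)"
  proof (rule nn_integral_cong_AE)
    show "AE \<omega> in M. (\<Sum>x. ennreal (real x * poisson_pf (\<Lambda> \<omega>) x)) = ennreal (\<Lambda> \<omega>)"
      using mixing_nonneg
    proof eventually_elim
      case (elim \<omega>)
      then show ?case
        by (intro suminf_ennreal_eq mult_nonneg_nonneg poisson_pf_nonneg poisson_pf_mean_sums) auto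
    qed
  qed
  also have "\<dots> = ennreal (expectation \<Lambda>)"
    by (rule nn_integral_eq_integral[OF mixing_integrable mixing_nonneg])
  finally show ?thesis .
qed

text \<open>Along almost every \<open>\<omega>\<close> the negative binomial component tends to the Poisson one with rate
  \<open>\<Lambda> \<omega>\<close>; probabilities are bounded by \<open>1\<close>, so the limit passes through the expectation.\<close>

lemma nbm_claim_pf_tendsto:
  "(\<lambda>n. nbm_claim_pf n x) \<longlonglongrightarrow> mixed_poisson_pf (distr M borel \<Lambda>) x"
  unfolding nbm_claim_pf_def mixed_poisson_pf_eq_expectation
proof (rule integral_dominated_convergence[where w = "\<lambda>_. 1"])
  show "AE \<omega> in M. (\<lambda>n. pmf (neg_binomial_pmf (grid n \<omega>) (real n / (real n + 1))) x)
      \<longlonglongrightarrow> poisson_pf (\<Lambda> \<omega>) x"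
    using mixing_nonneg
    by eventually_elim (intro neg_binomial_tendsto_poisson grid_quotient_tendsto)
qed (auto simp: pmf_le_1)

end

section \<open>Ruin probabilities of the approximating models and their limit\<close>

text \<open>The survival probability and the average of \<open>1 - C_bar F n\<close> over \<open>Z\<close> solve the same renewal
  equation, which has only one solution because claims vanish with positive probability.\<close>

lemma (in mixing_variable) nbm_ruin_formula:
  fixes u :: nat
  assumes n: "1 \<le> n" and iid: "iid_claims N W (nbm_claim_pf n)" and mean: "claim_mean N W \<le> 1"
  defines "F \<equiv> cdf (distr M borel \<Lambda>)"
  defines "Z \<equiv> neg_binomial_pmf u (1 / (1 + real n))"
  shows "(\<lambda>k. C_bar F n k * pmf Z k) sums ruin_prob N W u"
    and "integrable (measure_pmf Z) (C_bar F n)"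
    and "ruin_prob N W u = measure_pmf.expectation Z (C_bar F n)"
proof -
  define \<rho> where "\<rho> = 1 / (1 + real n)"
  have \<rho>: "\<rho> \<in> {0<..<1}" and "1 - \<rho> = real n * \<rho>"
    using n by (auto simp: \<rho>_def field_simps)
  then have odds: "(1 - \<rho>) / \<rho> = real n"
    by simp
  define \<mu> where "\<mu> = expectation (\<lambda>\<omega>. real (grid n \<omega>)) / real n"
  have \<mu>: "claim_mean N W = ennreal \<mu>" "0 \<le> \<mu>"
    by (simp_all add: \<mu>_def claim_mean_eq_sum[OF iid] nbm_claim_mean[OF n])
  with mean have \<mu>_le_1: "\<mu> \<le> 1" by simp
  define a where "a = (\<lambda>j. survival F (real j / real n) / real n)"
  have survival_nonneg: "0 \<le> survival F (real j / real n)" for j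
    by (simp add: F_def survival_eq_prob_grid[OF n])
  have a: "a sums \<mu>" "\<And>j. 0 \<le> a j"
    using survival_sums_expectation_grid[OF n] survival_nonneg by (simp_all add: a_def \<mu>_def F_def)
  define D where "D k = 1 - C_bar F n k" for k
  have D: "D k = (1 - \<mu>) + (\<Sum>i<k. a i * D (k - Suc i))" for k
    unfolding D_def a_def
    by (rule C_bar_renewal[OF n survival_nonneg a(1)[unfolded a_def]])
  note D_bounds = renewal_sequence_bounds[OF a(2,1) \<mu>_le_1 D]
  let ?\<Phi> = "\<lambda>u. measure_pmf.expectation (neg_binomial_pmf u \<rho>) D"
  have \<Phi>: "(\<lambda>k. D k * pmf (neg_binomial_pmf u \<rho>) k) sums ?\<Phi> u" for u
    using D_bounds by (intro pmf_nat_sums_expectation) auto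
  have tail: "(\<lambda>m. (1 - \<rho>) / \<rho> * a m * pmf (neg_binomial_pmf (Suc j) \<rho>) m) sums claim_tail (nbm_claim_pf n) j" for j
    using nbm_claim_tail_sums[OF n, of j] n unfolding odds by (simp add: a_def F_def \<rho>_def)
  have "1 - ruin_prob N W u = ?\<Phi> u"
  proof (rule renewal_unique)
    show "nbm_claim_pf n 0 \<noteq> 0"
      using nbm_claim_pf_0_pos[OF n] by simp
    show "1 - ruin_prob N W u = (1 - \<mu>) +
        (\<Sum>j<u. claim_tail (nbm_claim_pf n) j * (1 - ruin_prob N W (u - j)))" for u
      by (rule survival_prob_renewal[OF iid \<mu> \<mu>_le_1])
    show "?\<Phi> u = (1 - \<mu>) + (\<Sum>j<u. claim_tail (nbm_claim_pf n) j * ?\<Phi> (u - j))" for u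
      by (rule neg_binomial_average_renewal[OF \<rho> a(2) D_bounds D tail \<Phi>])
  qed
  then have ruin: "ruin_prob N W u = 1 - measure_pmf.expectation Z D"
    by (simp add: Z_def \<rho>_def)
  have C_bounded: "\<bar>C_bar F n k\<bar> \<le> 1" for k
    using D_bounds[of k] by (simp add: D_def)
  show int: "integrable (measure_pmf Z) (C_bar F n)"
    using C_bounded by (rule pmf_nat_sums_expectation(1))
  then have "measure_pmf.expectation Z D = 1 - measure_pmf.expectation Z (C_bar F n)"
    unfolding D_def[abs_def] by (subst Bochner_Integration.integral_diff) auto
  then show eq: "ruin_prob N W u = measure_pmf.expectation Z (C_bar F n)"
    by (simp add: ruin)
  show "(\<lambda>k. C_bar F n k * pmf Z k) sums ruin_prob N W u"
    unfolding eq using C_bounded by (rule pmf_nat_sums_expectation(2))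
qed

theorem theorem5p1:
  fixes L :: "'l measure" and \<Lambda> :: "'l \<Rightarrow> real" and F :: "real \<Rightarrow> real"
    and M :: "'m measure" and Y :: "nat \<Rightarrow> 'm \<Rightarrow> nat"
    and N :: "nat \<Rightarrow> 'n measure" and W :: "nat \<Rightarrow> nat \<Rightarrow> 'n \<Rightarrow> nat"
    and \<psi> :: "nat \<Rightarrow> real" and \<psi>n :: "nat \<Rightarrow> nat \<Rightarrow> real"
  assumes "prob_space L" and "\<Lambda> \<in> borel_measurable L" and "AE \<omega> in L. 0 \<le> \<Lambda> \<omega>"
    and "integrable L \<Lambda>" and "(LINT \<omega>|L. \<Lambda> \<omega>) < 1"
    and F: "F = cdf (distr L borel \<Lambda>)"
    and "iid_claims M Y (mixed_poisson_pf (distr L borel \<Lambda>))"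
    and \<psi>: "\<psi> = ruin_prob M Y"
    and "\<And>n. n \<ge> 1 \<Longrightarrow>
           iid_claims (N n) (W n) (nbm_pf (nbm_weight F n) (real n / (real n + 1)))"
    and \<psi>n: "\<And>n. n \<ge> 1 \<Longrightarrow> \<psi>n n = ruin_prob (N n) (W n)"
  shows "(\<forall>u. (\<lambda>n. \<psi>n n u) \<longlonglongrightarrow> \<psi> u) \<and>
    (\<forall>\<^sub>F n in sequentially. claim_mean (N n) (W n) < 1) \<and>
    (\<forall>n\<ge>1. claim_mean (N n) (W n) \<le> 1 \<longrightarrow>
       (\<forall>u. (\<lambda>k. C_bar F n k * pmf (neg_binomial_pmf u (1 / (1 + real n))) k) sums \<psi>n n u \<and>
            integrable (measure_pmf (neg_binomial_pmf u (1 / (1 + real n)))) (C_bar F n) \<and>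
            \<psi>n n u = measure_pmf.expectation (neg_binomial_pmf u (1 / (1 + real n))) (C_bar F n)))"
proof -
  interpret mixing_variable L \<Lambda>
    using assms(1-4) by (simp add: mixing_variable_def mixing_variable_axioms_def)
  define \<mu> where "\<mu> = expectation \<Lambda>"
  define \<mu>n where "\<mu>n n = expectation (\<lambda>\<omega>. real (grid n \<omega>)) / real n" for n
  let ?f = "mixed_poisson_pf (distr L borel \<Lambda>)"
  have \<mu>: "0 \<le> \<mu>" "\<mu> < 1"
    using mixing_nonneg assms(5) by (auto simp: \<mu>_def intro: integral_nonneg_AE)
  have iid: "iid_claims M Y ?f"
    by fact
  have iid_n: "iid_claims (N n) (W n) (nbm_claim_pf n)" if "1 \<le> n" for n
    using assms(9)[OF that] by (simp only: F nbm_pf_eq_nbm_claim_pf[OF that])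
  have mean: "claim_mean M Y = ennreal \<mu>"
    by (simp add: claim_mean_eq_sum[OF iid] mixed_poisson_mean \<mu>_def)
  have mean_n: "claim_mean (N n) (W n) = ennreal (\<mu>n n)" "0 \<le> \<mu>n n" if "1 \<le> n" for n
    by (simp_all add: claim_mean_eq_sum[OF iid_n[OF that]] nbm_claim_mean[OF that] \<mu>n_def)
  have \<mu>n_tendsto: "\<mu>n \<longlonglongrightarrow> \<mu>"
    using expectation_grid_tendsto by (simp add: \<mu>n_def[abs_def] \<mu>_def)
  then have \<mu>n_less_1: "\<forall>\<^sub>F n in sequentially. \<mu>n n < 1"
    using \<mu>(2) by (rule order_tendstoD)
  have "(\<lambda>n. 1 - \<psi>n n u) \<longlonglongrightarrow> 1 - \<psi> u" for u
  proof (rule renewal_continuity[where f = ?f and fn = nbm_claim_pf and cn = "\<lambda>n. 1 - \<mu>n n" and c = "1 - \<mu>"])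
    show "?f 0 \<noteq> 0"
      using mixed_poisson_pf_0_pos by simp
    show "(\<lambda>n. 1 - \<mu>n n) \<longlonglongrightarrow> 1 - \<mu>"
      by (intro tendsto_intros \<mu>n_tendsto)
    show "1 - \<psi> u = (1 - \<mu>) + (\<Sum>j<u. claim_tail ?f j * (1 - \<psi> (u - j)))" for u
      unfolding \<psi> using \<mu> by (intro survival_prob_renewal[OF iid mean]) auto
    show "\<forall>\<^sub>F n in sequentially. \<forall>u. 1 - \<psi>n n u =
        (1 - \<mu>n n) + (\<Sum>j<u. claim_tail (nbm_claim_pf n) j * (1 - \<psi>n n (u - j)))"
      using \<mu>n_less_1 eventually_ge_at_top[of 1]
    proof eventually_elim
      case (elim n)
      show ?case
        unfolding \<psi>n[OF elim(2)]
        using survival_prob_renewal[OF iid_n mean_n, OF elim(2) elim(2) elim(2)] elim(1) by simp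
    qed
  qed (rule nbm_claim_pf_tendsto)
  from tendsto_diff[OF tendsto_const[of 1] this]
  have "(\<lambda>n. \<psi>n n u) \<longlonglongrightarrow> \<psi> u" for u
    by simp
  moreover have "\<forall>\<^sub>F n in sequentially. claim_mean (N n) (W n) < 1"
    using \<mu>n_less_1 eventually_ge_at_top[of 1]
    by eventually_elim (simp add: mean_n)
  moreover note nbm_ruin_formula[OF _ iid_n, folded F] \<psi>n
  ultimately show ?thesis by simp
qed

end
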